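(* Let $X$ be a random vector in $\mathbb{R}^d$. Let $b\in\mathbb{R}^d$ and let $\nu$ be a Lévy measure on $\mathbb{R}^d$ such that, for all $c>0$, $\nu(du)=c^{-1}T_c(\nu)(du)$. Moreover, let $\sigma$, the spherical part of $\nu$, be such that $\int_{\mathbb{S}^{d-1}}x\,\sigma(dx)=0$. Then $$\mathbb{E}\langle X;\nabla f(X)\rangle=\mathbb{E}\langle b;\nabla f(X)\rangle+\mathbb{E}\int_{\mathbb{R}^d}\big(f(X+u)-f(X)-\langle\nabla f(X);u\rangle\mathbf 1_{\|u\|\le1}\big)\nu(du)$$ holds for all $f\in\mathcal{S}(\mathbb{R}^d)$ if and only if $X$ is a stable random vector in $\mathbb{R}^d$ with parameter $b$, stability index $\alpha=1$ and Lévy measure $\nu$.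
   Context: $\|\cdot\|$, $\langle\cdot;\cdot\rangle$ are the Euclidean norm and inner product on $\mathbb{R}^d$; $\mathcal{S}(\mathbb{R}^d)$ is the Schwartz space of real-valued rapidly decreasing smooth functions. A Lévy measure is a positive Borel measure $\nu$ on $\mathbb{R}^d$ with $\nu(\{0\})=0$ and $\int(1\wedge\|u\|^2)\nu(du)<+\infty$. For $c>0$, $T_c(\nu)(B)=\nu(B/c)$ for all Borel sets $B$. Under the scaling $\nu=c^{-1}T_c(\nu)$ for all $c>0$, $\nu$ has the polar form $\nu(du)=\mathbf 1_{(0,+\infty)}(r)\mathbf 1_{\mathbb{S}^{d-1}}(x)\frac{dr}{r^{2}}\sigma(dx)$ ($u=rx$), where $\sigma$ is a finite positive measure on the unit sphere $\mathbb{S}^{d-1}$, called the spherical part of $\nu$. "$X$ is stable with parameter $b$, stability index $1$ and Lévy measure $\nu$" means that $X$ has characteristic function $\varphi(\xi)=\exp\big(i\langle b;\xi\rangle+\int_{\mathbb{R}^d}(e^{i\langle\xi;u\rangle}-1-i\langle\xi;u\rangle\mathbf 1_{\|u\|\le1})\nu(du)\big)$. *)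

theory Defs
  imports "HOL-Probability.Probability"
begin

text \<open>The space \<open>\<real>\<^sup>d\<close> is an arbitrary \<open>'a::euclidean_space\<close>, with \<open>d = DIM('a)\<close>.\<close>

definition gradient :: "('a::euclidean_space \<Rightarrow> real) \<Rightarrow> 'a \<Rightarrow> 'a" where
  "gradient f x = (THE D. GDERIV f x :> D)"

text \<open>A multi-index is given by the list of basis directions along which one differentiates.\<close>

primrec iterated_partial ::
  "'a::euclidean_space list \<Rightarrow> ('a \<Rightarrow> real) \<Rightarrow> 'a \<Rightarrow> real" where
  "iterated_partial [] f = f"
| "iterated_partial (e # es) f = (\<lambda>x. frechet_derivative (iterated_partial es f) (at x) e)"

text \<open>
  If all iterated partial derivatives are Frechet differentiable, they are in particular all
  continuous, so the first condition expresses that \<open>f\<close> is of class \<open>C\<^sup>\<infinity>\<close>.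
\<close>

definition schwartz_function :: "('a::euclidean_space \<Rightarrow> real) \<Rightarrow> bool" where
  "schwartz_function f \<longleftrightarrow>
     (\<forall>es. set es \<subseteq> Basis \<longrightarrow>
        iterated_partial es f differentiable_on UNIV \<and>
        (\<forall>k::nat. bounded (range (\<lambda>x. norm x ^ k * iterated_partial es f x))))"

definition levy_measure :: "'a::euclidean_space measure \<Rightarrow> bool" where
  "levy_measure \<nu> \<longleftrightarrow>
     sets \<nu> = sets borel \<and> emeasure \<nu> {0} = 0 \<and>
     (\<integral>\<^sup>+u. ennreal (min 1 ((norm u)\<^sup>2)) \<partial>\<nu>) < \<infinity>"

text \<open>\<open>T\<^sub>c(\<nu>)(B) = \<nu>(B/c)\<close> for \<open>c > 0\<close>, i.e. the push-forward of \<open>\<nu>\<close> under \<open>u \<mapsto> c u\<close>.\<close>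

definition dilate_measure ::
  "real \<Rightarrow> 'a::euclidean_space measure \<Rightarrow> 'a measure" where
  "dilate_measure c \<nu> = distr \<nu> borel (\<lambda>u. c *\<^sub>R u)"

text \<open>
  \<open>\<sigma>\<close> is the spherical part of \<open>\<nu>\<close> in the polar form \<open>\<nu>(du) = dr/r\<^sup>2 \<sigma>(dx)\<close>, \<open>u = r x\<close>,
  specific to stability index 1.
\<close>

definition spherical_part ::
  "'a::euclidean_space measure \<Rightarrow> 'a measure \<Rightarrow> bool" where
  "spherical_part \<nu> \<sigma> \<longleftrightarrow>
     finite_measure \<sigma> \<and> sets \<sigma> = sets (restrict_space borel (sphere 0 1)) \<and>
     (\<forall>B\<in>sets borel. emeasure \<nu> B =
        (\<integral>\<^sup>+x. (\<integral>\<^sup>+r\<in>{0<..}. indicator B (r *\<^sub>R x) * ennreal (1 / r\<^sup>2) \<partial>lborel) \<partial>\<sigma>))"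

definition char_fun ::
  "'w measure \<Rightarrow> ('w \<Rightarrow> 'a::euclidean_space) \<Rightarrow> 'a \<Rightarrow> complex" where
  "char_fun M X \<xi> = (CLINT \<omega>|M. iexp (\<xi> \<bullet> X \<omega>))"

text \<open>
  \<open>X\<close> is stable with parameter \<open>b\<close>, stability index 1 and Levy measure \<open>\<nu>\<close>. This is only
  meaningful for a Levy measure \<open>\<nu>\<close> satisfying the scaling \<open>\<nu> = c\<^sup>-\<^sup>1 T\<^sub>c(\<nu>)\<close> for all \<open>c > 0\<close>,
  which is what makes the index equal to 1.
\<close>

definition stable_index_1 ::
  "'w measure \<Rightarrow> ('w \<Rightarrow> 'a::euclidean_space) \<Rightarrow> 'a \<Rightarrow> 'a measure \<Rightarrow> bool" where
  "stable_index_1 M X b \<nu> \<longleftrightarrow>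
     (\<forall>\<xi>. char_fun M X \<xi> =
        exp (\<i> * of_real (b \<bullet> \<xi>) +
             (CLINT u|\<nu>. iexp (\<xi> \<bullet> u) - 1
                - \<i> * of_real ((\<xi> \<bullet> u) * indicator {u. norm u \<le> 1} u))))"

end

theory Submission
  imports Defs
begin

text \<open>
  Write \<open>\<phi>\<close> for the characteristic function of \<open>X\<close> and \<open>\<eta>(\<xi>)\<close> for the exponent in the stable law.
  The scaling of \<open>\<nu>\<close> and the centering of \<open>\<sigma>\<close> give \<open>\<eta>(t\<xi>) = t \<eta>(\<xi>)\<close> for \<open>t > 0\<close>, so stability
  means that \<open>t \<mapsto> \<phi>(t\<xi>)\<close> solves \<open>y' = \<eta>(\<xi>) y\<close>, and this is the identity of the theorem
  for \<open>f(x) = exp(i \<langle>\<xi>;x\<rangle>)\<close>, except that \<open>\<langle>X;\<nabla>f(X)\<rangle>\<close> need not be integrable for such \<open>f\<close>.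

  From the identity to stability: test it on \<open>cos(\<langle>\<tau>\<xi>;x\<rangle> + \<theta>) exp(-\<parallel>x/n\<parallel>\<^sup>2/2)\<close>, integrate over \<open>\<tau>\<close>
  in a compact subinterval of \<open>(0,\<infinity>)\<close> and let \<open>n\<close> tend to infinity.

  From stability to the identity: the convolution of a Schwartz function with a Gaussian is a
  superposition of exponentials with respect to a finite complex measure with second moments.
  For such an \<open>h\<close> the derivative of \<open>E h(tX)\<close> at \<open>t = 1\<close> is computed once under the expectation
  and once under the superposition. The width of the Gaussian then tends to zero; no Fourier
  inversion on \<open>\<real>\<^sup>d\<close> is needed.
\<close>

section \<open>Second-order Taylor bounds\<close>

text \<open>The obstacle is that no moment of X is available. When the identity is given, it
  controls only \<tau> times the \<tau>-derivative of the damped cosine, so dividing by \<tau>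
  forces the interval away from 0. Integrating that derivative removes the unbounded factor
  <\<xi>;X> and leaves differences of cosines, which survive the limit; continuity of \<phi> at 0
  then supplies the initial value 1. When stability is given, the difference quotients of h(tX) are
  bounded because the gradient of h decays like 1/norm x along each ray.

  Every exchange of limits on the side of the jumps rests on three bounds (value, gradient,
  quadratic remainder) with a single constant. They are inherited by contractions of the argument
  and by averages over translates with the same constant, so neither cutoffs nor convolutions spoil
  uniformity.

  The second moments match the growth of \<eta>, which is at most quadratic. The Gaussian
  convolution meets this demand because its weight is a Fourier transform of an integrable function,
  hence bounded, and the reference measure is itself Gaussian.\<close>

lemma taylor_of_lipschitz_gradient:
  fixes f :: "'a::euclidean_space \<Rightarrow> real"
  assumes deriv: "\<And>x. (f has_derivative (\<lambda>h. D x \<bullet> h)) (at x)"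
    and lip: "\<And>x y. norm (D x - D y) \<le> L * norm (x - y)"
  shows "\<bar>f (x + u) - f x - D x \<bullet> u\<bar> \<le> L * (norm u)\<^sup>2"
proof -
  \<comment> \<open>With the linear part removed, the derivative of \<open>p\<close> is a gradient
    increment, so a single use of the mean value theorem gives the quadratic bound. The price is the
    constant L instead of L/2.\<close>
  define p where "p s = f (x + s *\<^sub>R u) - s * (D x \<bullet> u)" for s
  have "(p has_derivative (\<lambda>h. h * ((D (x + s *\<^sub>R u) - D x) \<bullet> u))) (at s)" for s
    unfolding p_def
    by (rule derivative_eq_intros has_derivative_compose[OF _ deriv] refl
        | simp add: algebra_simps inner_diff_left)+
  then have p': "(p has_real_derivative (D (x + s *\<^sub>R u) - D x) \<bullet> u) (at s)" for s
    by (simp add: has_field_derivative_def mult_commute_abs)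
  obtain s where s: "0 < s" "s < 1" "p 1 - p 0 = (1 - 0) * ((D (x + s *\<^sub>R u) - D x) \<bullet> u)"
    using MVT2[of 0 1 p "\<lambda>s. (D (x + s *\<^sub>R u) - D x) \<bullet> u"] p' by auto
  have "\<bar>f (x + u) - f x - D x \<bullet> u\<bar> = \<bar>(D (x + s *\<^sub>R u) - D x) \<bullet> u\<bar>"
    using s(3) by (simp add: p_def)
  also have "\<dots> \<le> norm (D (x + s *\<^sub>R u) - D x) * norm u" by (rule Cauchy_Schwarz_ineq2)
  also have "\<dots> \<le> (L * norm (s *\<^sub>R u)) * norm u"
    using lip[of "x + s *\<^sub>R u" x] by (intro mult_right_mono) auto
  also have "\<dots> \<le> L * (norm u)\<^sup>2"
  proof (cases "u = 0")
    case False
    \<comment> \<open>The sign of L is read off from \<open>lip\<close> at two distinct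
      points.\<close>
    have "0 \<le> norm (D (x + u) - D x)" by simp
    also have "\<dots> \<le> L * norm u" using lip[of "x+u" x] by simp
    finally have "L \<ge> 0" using False by (simp add: zero_le_mult_iff)
    then have "s * (L * (norm u)\<^sup>2) \<le> 1 * (L * (norm u)\<^sup>2)" using s by (intro mult_right_mono) auto
    then show ?thesis using s(1) by (simp add: power2_eq_square mult_ac)
  qed simp
  finally show ?thesis .
qed

lemma gradient_eqI: "(f has_derivative (\<lambda>h. D \<bullet> h)) (at x) \<Longrightarrow> gradient f x = D"
  unfolding gradient_def
proof (rule the_equality)
  assume d: "(f has_derivative (\<lambda>h. D \<bullet> h)) (at x)"
  then show "GDERIV f x :> D" by (simp add: gderiv_def inner_commute)
  fix D' assume "GDERIV f x :> D'"
  then have "(f has_derivative (\<lambda>h. h \<bullet> D')) (at x)" by (simp add: gderiv_def)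
  from has_derivative_unique[OF this d] have "h \<bullet> D' = h \<bullet> D" for h by (metis inner_commute)
  then show "D' = D" using vector_eq_ldot by blast
qed

text \<open>Bridges the two notions of derivative: \<open>schwartz_function\<close> bounds partial
  derivatives coordinate by coordinate, while the identity speaks of
  \<open>gradient\<close>.\<close>

lemma has_derivative_gradient:
  fixes f :: "'a::euclidean_space \<Rightarrow> real"
  assumes "f differentiable (at x)"
  shows "gradient f x = (\<Sum>e\<in>Basis. frechet_derivative f (at x) e *\<^sub>R e)"
    and "(f has_derivative (\<lambda>h. gradient f x \<bullet> h)) (at x)"
proof -
  let ?d = "frechet_derivative f (at x)" and ?D = "(\<Sum>e\<in>Basis. frechet_derivative f (at x) e *\<^sub>R e)"
  have d: "(f has_derivative ?d) (at x)" using assms frechet_derivative_works by blast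
  then have lin: "linear ?d" by (rule has_derivative_linear)
  have "?d = (\<lambda>h. ?D \<bullet> h)"
  proof
    fix h
    have "?d h = ?d (\<Sum>e\<in>Basis. (h \<bullet> e) *\<^sub>R e)" by (simp add: euclidean_representation)
    also have "\<dots> = (\<Sum>e\<in>Basis. (h \<bullet> e) * ?d e)" using lin by (simp add: linear_sum linear_scale)
    finally show "?d h = ?D \<bullet> h" by (simp add: inner_sum_left inner_sum_right inner_commute mult.commute)
  qed
  with d have "(f has_derivative (\<lambda>h. ?D \<bullet> h)) (at x)" by simp
  then show "gradient f x = ?D" "(f has_derivative (\<lambda>h. gradient f x \<bullet> h)) (at x)"
    using gradient_eqI by metis+
qed

text \<open>These are the bounds that dominate the jump integrand uniformly in x. The field
  \<open>D\<close> is a separate argument so that it can be convolved, rescaled or passed to a limit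
  along with the function; that it is the gradient is forced by the last condition.\<close>

definition tame :: "real \<Rightarrow> ('a::euclidean_space \<Rightarrow> real) \<Rightarrow> ('a \<Rightarrow> 'a) \<Rightarrow> bool" where
  "tame C f D \<longleftrightarrow> D \<in> borel_measurable borel \<and> (\<forall>x. \<bar>f x\<bar> \<le> C) \<and> (\<forall>x. norm (D x) \<le> C) \<and>
     (\<forall>x u. \<bar>f (x + u) - f x - D x \<bullet> u\<bar> \<le> C * (norm u)\<^sup>2)"

lemma tameD:
  assumes "tame C f D"
  shows "D \<in> borel_measurable borel" "\<bar>f x\<bar> \<le> C" "norm (D x) \<le> C"
    "\<bar>f (x + u) - f x - D x \<bullet> u\<bar> \<le> C * (norm u)\<^sup>2" "C \<ge> 0"
  using assms order_trans[OF abs_ge_zero[of "f 0"], of C] unfolding tame_def by auto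

lemma tame_mono: "tame C f D \<Longrightarrow> C \<le> C' \<Longrightarrow> tame C' f D"
  unfolding tame_def by (smt (verit, best) mult_right_mono zero_le_power2)

lemma tame_has_derivative:
  assumes "tame C f D"
  shows "(f has_derivative (\<lambda>h. D x \<bullet> h)) (at x)"
  unfolding has_derivative_at
proof (intro conjI bounded_linear_inner_right)
  have lim: "((\<lambda>h::'a. C * norm h) \<longlongrightarrow> 0) (at 0)"
    by (intro tendsto_mult_right_zero tendsto_norm_zero tendsto_ident_at)
  have le: "norm (norm (f (x + h) - f x - D x \<bullet> h) / norm h) \<le> C * norm h" for h
    using tameD(4)[OF assms, of x h] tameD(5)[OF assms]
    by (cases "h = 0") (simp_all add: divide_simps power2_eq_square mult_ac)
  show "(\<lambda>h. norm (f (x + h) - f x - D x \<bullet> h) / norm h) \<midarrow>0\<rightarrow> 0"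
    by (rule Lim_null_comparison[OF always_eventually[OF allI[OF le]] lim])
qed

lemma tame_measurable: "tame C f D \<Longrightarrow> f \<in> borel_measurable borel"
  by (intro borel_measurable_continuous_onI continuous_at_imp_continuous_on ballI
      has_derivative_continuous[OF tame_has_derivative])

text \<open>Two regimes share the constant 2C: for short u the linear term and the remainder cost C
  each, for long u the oscillation of a function bounded by C is at most 2C.\<close>

lemma tame_lipschitz:
  assumes "tame C f D"
  shows "\<bar>f (x + u) - f x\<bar> \<le> 2 * C * norm u"
proof (cases "norm u \<le> 1")
  case True
  have "\<bar>D x \<bullet> u\<bar> \<le> C * norm u"
    using tameD(3)[OF assms, of x] Cauchy_Schwarz_ineq2[of "D x" u] by (meson mult_right_mono norm_ge_zero order_trans)
  moreover have "C * (norm u)\<^sup>2 \<le> C * norm u"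
    using True tameD(5)[OF assms] by (simp add: power2_eq_square mult_left_le mult_left_mono)
  ultimately show ?thesis using tameD(4)[OF assms, of x u] by linarith
next
  case False
  then have "2 * C * 1 \<le> 2 * C * norm u" using tameD(5)[OF assms] by (intro mult_left_mono) auto
  then show ?thesis using tameD(2)[OF assms, of x] tameD(2)[OF assms, of "x+u"] by linarith
qed

lemma tame_mult:
  assumes f: "tame A f D" and g: "tame B g E"
  shows "tame (4 * A * B) (\<lambda>x. f x * g x) (\<lambda>x. g x *\<^sub>R D x + f x *\<^sub>R E x)"
  unfolding tame_def
proof (intro conjI allI)
  note nn = tameD(5)[OF f] tameD(5)[OF g]
  note [measurable] = tameD(1)[OF f] tameD(1)[OF g] tame_measurable[OF f] tame_measurable[OF g]
  show "(\<lambda>x. g x *\<^sub>R D x + f x *\<^sub>R E x) \<in> borel_measurable borel" by measurable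
  have le: "A * B \<le> 4 * A * B" "2 * (A * B) \<le> 4 * A * B" using nn by auto
  fix x
  have "\<bar>f x * g x\<bar> \<le> A * B"
    using tameD(2)[OF f, of x] tameD(2)[OF g, of x] by (simp add: abs_mult mult_mono' )
  then show "\<bar>f x * g x\<bar> \<le> 4 * A * B" using le by linarith
  have "norm (g x *\<^sub>R D x) \<le> B * A" and "norm (f x *\<^sub>R E x) \<le> A * B"
    using tameD(2)[OF f, of x] tameD(2)[OF g, of x] tameD(3)[OF f, of x] tameD(3)[OF g, of x]
    by (simp_all add: mult_mono')
  then show "norm (g x *\<^sub>R D x + f x *\<^sub>R E x) \<le> 4 * A * B"
    using norm_triangle_ineq[of "g x *\<^sub>R D x" "f x *\<^sub>R E x"] le(2) mult.commute[of A B] by linarith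
  fix u
  \<comment> \<open>The Leibniz rule with remainders. The three terms cost AB, AB and 2AB times the
    square of norm u, whence the factor 4.\<close>
  have eq: "f (x + u) * g (x + u) - f x * g x - (g x *\<^sub>R D x + f x *\<^sub>R E x) \<bullet> u
    = (f (x + u) - f x - D x \<bullet> u) * g (x + u) + f x * (g (x + u) - g x - E x \<bullet> u)
      + (D x \<bullet> u) * (g (x + u) - g x)"
    by (simp add: algebra_simps inner_add_left)
  have a1: "\<bar>(f (x + u) - f x - D x \<bullet> u) * g (x + u)\<bar> \<le> (A * (norm u)\<^sup>2) * B"
    unfolding abs_mult using tameD[OF f] tameD[OF g] by (intro mult_mono') auto
  have a2: "\<bar>f x * (g (x + u) - g x - E x \<bullet> u)\<bar> \<le> A * (B * (norm u)\<^sup>2)"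
    unfolding abs_mult using tameD[OF f] tameD[OF g] by (intro mult_mono') auto
  have a3: "\<bar>(D x \<bullet> u) * (g (x + u) - g x)\<bar> \<le> (A * norm u) * (2 * B * norm u)"
    unfolding abs_mult using tameD(3)[OF f, of x] tame_lipschitz[OF g, of x u]
    by (intro mult_mono' order_trans[OF Cauchy_Schwarz_ineq2]) (auto intro!: mult_right_mono)
  have "\<bar>f (x + u) * g (x + u) - f x * g x - (g x *\<^sub>R D x + f x *\<^sub>R E x) \<bullet> u\<bar> \<le>
      (A * (norm u)\<^sup>2) * B + A * (B * (norm u)\<^sup>2) + (A * norm u) * (2 * B * norm u)"
    unfolding eq
    by (rule order_trans[OF abs_triangle_ineq add_mono[OF order_trans[OF abs_triangle_ineq add_mono[OF a1 a2]] a3]])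
  then show "\<bar>f (x + u) * g (x + u) - f x * g x - (g x *\<^sub>R D x + f x *\<^sub>R E x) \<bullet> u\<bar> \<le> 4 * A * B * (norm u)\<^sup>2"
    by (simp add: power2_eq_square algebra_simps)
qed

text \<open>The constant does not depend on c. A cutoff that is flattened by letting c tend to 0
  therefore stays within one dominating bound.\<close>

lemma tame_scale:
  assumes f: "tame C f D" and "\<bar>c\<bar> \<le> 1"
  shows "tame C (\<lambda>x. f (c *\<^sub>R x)) (\<lambda>x. c *\<^sub>R D (c *\<^sub>R x))"
  unfolding tame_def
proof (intro conjI allI)
  note [measurable] = tameD(1)[OF f]
  show "(\<lambda>x. c *\<^sub>R D (c *\<^sub>R x)) \<in> borel_measurable borel" by measurable
  fix x
  show "\<bar>f (c *\<^sub>R x)\<bar> \<le> C" using tameD(2)[OF f] .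
  show "norm (c *\<^sub>R D (c *\<^sub>R x)) \<le> C"
    using mult_mono'[OF assms(2) tameD(3)[OF f, of "c *\<^sub>R x"]] by simp
  fix u
  have "\<bar>f (c *\<^sub>R (x + u)) - f (c *\<^sub>R x) - c *\<^sub>R D (c *\<^sub>R x) \<bullet> u\<bar> \<le> C * (norm (c *\<^sub>R u))\<^sup>2"
    using tameD(4)[OF f, of "c *\<^sub>R x" "c *\<^sub>R u"] by (simp add: algebra_simps)
  also have "\<dots> \<le> C * (norm u)\<^sup>2"
    using assms(2) tameD(5)[OF f] by (intro mult_left_mono power_mono) (auto simp: mult_left_le_one_le)
  finally show "\<bar>f (c *\<^sub>R (x + u)) - f (c *\<^sub>R x) - c *\<^sub>R D (c *\<^sub>R x) \<bullet> u\<bar> \<le> C * (norm u)\<^sup>2" .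
qed

lemma cos_taylor2: "\<bar>cos (a + v) - cos a + v * sin a\<bar> \<le> (v::real)\<^sup>2"
proof -
  have "((\<lambda>x. cos (a + x \<bullet> 1)) has_derivative (\<lambda>h. (- sin (a + x)) \<bullet> h)) (at x)" for x :: real
    by (auto intro!: derivative_eq_intros)
  moreover have "norm (- sin (a + x) - - sin (a + y)) \<le> 1 * norm (x - y)" for x y :: real
  proof -
    have "((\<lambda>x. - sin (a + x)) has_real_derivative - cos (a + x)) (at x)" for x
      by (auto intro!: derivative_eq_intros)
    then show ?thesis
      by (intro field_differentiable_bound[where S=UNIV]) auto
  qed
  ultimately show ?thesis
    using taylor_of_lipschitz_gradient[of "\<lambda>x. cos (a + x)" "\<lambda>x. - sin (a + x)" 1 0 v]
    by (simp add: mult.commute)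
qed

text \<open>The constant dominates 1, \<open>norm \<xi>\<close> and
  \<open>(norm \<xi>)\<^sup>2\<close> simultaneously, which are the natural bounds for the value,
  the gradient and the remainder.\<close>

lemma tame_cos:
  fixes \<xi> :: "'a::euclidean_space"
  shows "tame (1 + (norm \<xi>)\<^sup>2) (\<lambda>x. cos (\<xi> \<bullet> x + \<theta>)) (\<lambda>x. - sin (\<xi> \<bullet> x + \<theta>) *\<^sub>R \<xi>)"
  unfolding tame_def
proof (intro conjI allI)
  show "(\<lambda>x. - sin (\<xi> \<bullet> x + \<theta>) *\<^sub>R \<xi>) \<in> borel_measurable borel" by measurable
  fix x
  show "\<bar>cos (\<xi> \<bullet> x + \<theta>)\<bar> \<le> 1 + (norm \<xi>)\<^sup>2"
    using abs_cos_le_one[of "\<xi> \<bullet> x + \<theta>"] zero_le_power2[of "norm \<xi>"] by linarith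
  have "norm (- sin (\<xi> \<bullet> x + \<theta>) *\<^sub>R \<xi>) \<le> norm \<xi>" by (simp add: mult_left_le_one_le)
  also have "\<dots> \<le> 1 + (norm \<xi>)\<^sup>2"
    using zero_le_power2[of "norm \<xi> - 1"] norm_ge_zero[of \<xi>] unfolding power2_diff by (simp, smt (verit))
  finally show "norm (- sin (\<xi> \<bullet> x + \<theta>) *\<^sub>R \<xi>) \<le> 1 + (norm \<xi>)\<^sup>2" .
  fix u
  have "\<bar>cos (\<xi> \<bullet> (x + u) + \<theta>) - cos (\<xi> \<bullet> x + \<theta>) - (- sin (\<xi> \<bullet> x + \<theta>) *\<^sub>R \<xi>) \<bullet> u\<bar> \<le> (\<xi> \<bullet> u)\<^sup>2"
    using cos_taylor2[of "\<xi> \<bullet> x + \<theta>" "\<xi> \<bullet> u"] by (simp add: algebra_simps)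
  also have "\<dots> \<le> (norm \<xi> * norm u)\<^sup>2" using power_mono[OF Cauchy_Schwarz_ineq2[of \<xi> u], of 2] by simp
  also have "\<dots> \<le> (1 + (norm \<xi>)\<^sup>2) * (norm u)\<^sup>2" by (simp add: algebra_simps)
  finally show "\<bar>cos (\<xi> \<bullet> (x + u) + \<theta>) - cos (\<xi> \<bullet> x + \<theta>) - (- sin (\<xi> \<bullet> x + \<theta>) *\<^sub>R \<xi>) \<bullet> u\<bar>
    \<le> (1 + (norm \<xi>)\<^sup>2) * (norm u)\<^sup>2" .
qed

section \<open>Schwartz functions: uniform bounds from the defining seminorms\<close>

lemma schwartz_bounded:
  assumes "schwartz_function f" "set es \<subseteq> Basis"
  obtains B where "B \<ge> 0" "\<And>x. norm x ^ k * \<bar>iterated_partial es f x\<bar> \<le> B"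
proof -
  from assms obtain B where "\<forall>y\<in>range (\<lambda>x. norm x ^ k * iterated_partial es f x). norm y \<le> B"
    unfolding schwartz_function_def bounded_iff by blast
  then have "norm x ^ k * \<bar>iterated_partial es f x\<bar> \<le> max 0 B" for x
    by (simp add: abs_mult le_max_iff_disj)
  then show ?thesis using that[of "max 0 B"] by simp
qed

text \<open>Bounded second partials make the gradient Lipschitz, hence the Taylor remainder
  quadratic. The weight of order one on the first partials gives the decay that makes <x;
  \<nabla>f(x)> bounded, so its expectation exists without any moment of X.\<close>

lemma schwartz_tame:
  fixes f :: "'a::euclidean_space \<Rightarrow> real"
  assumes f: "schwartz_function f"
  obtains C where "tame C f (gradient f)" "\<And>x. norm x * norm (gradient f x) \<le> C"
    "continuous_on UNIV (gradient f)"
proof -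
  have diff: "iterated_partial es f differentiable (at x)" if "set es \<subseteq> Basis" for es x
    using f that unfolding schwartz_function_def differentiable_on_def by simp
  have grad: "gradient f x = (\<Sum>e\<in>Basis. iterated_partial [e] f x *\<^sub>R e)"
    and df: "(f has_derivative (\<lambda>h. gradient f x \<bullet> h)) (at x)" for x
    using has_derivative_gradient[of f x] diff[of "[]" x] by simp_all
  obtain B0 where B0: "B0 \<ge> 0" "\<And>x. \<bar>f x\<bar> \<le> B0"
    using schwartz_bounded[OF f, of "[]" 0] by auto
  have "\<exists>B. \<forall>e\<in>Basis. \<forall>x. norm x ^ k * \<bar>iterated_partial [e] f x\<bar> \<le> B e" for k
  proof (rule bchoice, rule ballI)
    fix e :: 'a assume "e \<in> Basis"
    then show "\<exists>B. \<forall>x. norm x ^ k * \<bar>iterated_partial [e] f x\<bar> \<le> B"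
      using schwartz_bounded[OF f, of "[e]" k] by (metis empty_set empty_subsetI insert_subset list.simps(15))
  qed
  then obtain B1 where B1: "\<And>k e x. e \<in> Basis \<Longrightarrow> norm x ^ k * \<bar>iterated_partial [e] f x\<bar> \<le> B1 k e"
    by metis
  have "\<exists>B. \<forall>p\<in>Basis\<times>Basis. \<forall>x. \<bar>iterated_partial [fst p, snd p] f x\<bar> \<le> B p"
  proof (rule bchoice, rule ballI)
    fix p :: "'a \<times> 'a" assume "p \<in> Basis \<times> Basis"
    then have "set [fst p, snd p] \<subseteq> Basis" by auto
    then obtain B where "\<And>x. norm x ^ 0 * \<bar>iterated_partial [fst p, snd p] f x\<bar> \<le> B"
      using schwartz_bounded[OF f, of "[fst p, snd p]" 0] by metis
    then show "\<exists>B. \<forall>x. \<bar>iterated_partial [fst p, snd p] f x\<bar> \<le> B" by auto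
  qed
  then obtain B2 where B2: "\<And>e e' x. e \<in> Basis \<Longrightarrow> e' \<in> Basis \<Longrightarrow> \<bar>iterated_partial [e', e] f x\<bar> \<le> B2 (e', e)"
    by fastforce
  have g: "norm x ^ k * norm (gradient f x) \<le> (\<Sum>e\<in>Basis. B1 k e)" for x k
  proof -
    have "norm (gradient f x) \<le> (\<Sum>e\<in>Basis. \<bar>iterated_partial [e] f x\<bar>)"
      unfolding grad by (rule sum_norm_le) simp
    then have "norm x ^ k * norm (gradient f x) \<le> (\<Sum>e\<in>Basis. norm x ^ k * \<bar>iterated_partial [e] f x\<bar>)"
      by (simp add: mult_left_mono flip: sum_distrib_left)
    also have "\<dots> \<le> (\<Sum>e\<in>Basis. B1 k e)" by (intro sum_mono B1)
    finally show ?thesis .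
  qed
  define L where "L = (\<Sum>e\<in>Basis. \<Sum>e'\<in>Basis. B2 (e', e))"
  \<comment> \<open>The head of the list \<open>[e', e]\<close> is the outer derivative, so for
    fixed e the sum over e' bounds the gradient of the e-th partial derivative.\<close>
  have lip1: "\<bar>iterated_partial [e] f x - iterated_partial [e] f y\<bar> \<le> (\<Sum>e'\<in>Basis. B2 (e', e)) * norm (x - y)"
    if e: "e \<in> Basis" for e x y
  proof -
    let ?h = "iterated_partial [e] f"
    have d: "?h differentiable (at z)" for z using diff[of "[e]"] e by simp
    have n: "norm (gradient ?h z) \<le> (\<Sum>e'\<in>Basis. B2 (e', e))" for z
      unfolding has_derivative_gradient(1)[OF d]
      using B2[OF e] by (intro sum_norm_le) simp
    have o: "onorm (\<lambda>h. gradient ?h z \<bullet> h) \<le> (\<Sum>e'\<in>Basis. B2 (e', e))" for z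
      by (rule onorm_le, unfold real_norm_def)
        (rule order_trans[OF Cauchy_Schwarz_ineq2 mult_right_mono[OF n norm_ge_zero]])
    have "norm (?h x - ?h y) \<le> (\<Sum>e'\<in>Basis. B2 (e', e)) * norm (x - y)"
      by (rule differentiable_bound[of UNIV ?h "\<lambda>z h. gradient ?h z \<bullet> h"])
        (use has_derivative_gradient(2)[OF d] o in auto)
    then show ?thesis by simp
  qed
  have lip: "norm (gradient f x - gradient f y) \<le> L * norm (x - y)" for x y
  proof -
    have "gradient f x - gradient f y = (\<Sum>e\<in>Basis. (iterated_partial [e] f x - iterated_partial [e] f y) *\<^sub>R e)"
      unfolding grad by (simp add: scaleR_diff_left sum_subtractf)
    also have "norm \<dots> \<le> (\<Sum>e\<in>Basis. (\<Sum>e'\<in>Basis. B2 (e', e)) * norm (x - y))"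
      by (rule sum_norm_le) (use lip1 in simp)
    also have "\<dots> = L * norm (x - y)" by (simp add: L_def sum_distrib_right)
    finally show ?thesis .
  qed
  have cont: "continuous_on UNIV (gradient f)"
  proof (subst grad[abs_def], intro continuous_intros)
    fix e :: 'a assume "e \<in> Basis"
    then have "iterated_partial [e] f differentiable_on UNIV"
      using diff[of "[e]"] by (simp add: differentiable_on_def)
    then show "continuous_on UNIV (iterated_partial [e] f)" by (rule differentiable_imp_continuous_on)
  qed
  define C where "C = max (max B0 L) (max (\<Sum>e\<in>Basis. B1 0 e) (\<Sum>e\<in>Basis. B1 1 e))"
  have C: "B0 \<le> C" "L \<le> C" "(\<Sum>e\<in>Basis. B1 0 e) \<le> C" "(\<Sum>e\<in>Basis. B1 1 e) \<le> C" 
    by (auto simp only: C_def le_max_iff_disj order_refl)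
  have "tame C f (gradient f)" unfolding tame_def
  proof (intro conjI allI)
    show "gradient f \<in> borel_measurable borel" using cont by (rule borel_measurable_continuous_onI)
    fix x
    show "\<bar>f x\<bar> \<le> C" using B0(2)[of x] C by linarith
    show "norm (gradient f x) \<le> C" using g[of x 0] C by simp
    fix u
    show "\<bar>f (x + u) - f x - gradient f x \<bullet> u\<bar> \<le> C * (norm u)\<^sup>2"
      using taylor_of_lipschitz_gradient[OF df lip, of x u] C(2)
      by (meson mult_right_mono order_trans zero_le_power2)
  qed
  moreover have "norm x * norm (gradient f x) \<le> C" for x using g[of x 1] C by simp
  ultimately show ?thesis using cont that by blast
qed

section \<open>The generator and its exponent\<close>

definition jump :: "('a::euclidean_space \<Rightarrow> real) \<Rightarrow> ('a \<Rightarrow> 'a) \<Rightarrow> 'a \<Rightarrow> 'a \<Rightarrow> real" where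
  "jump f D x u = f (x + u) - f x - (D x \<bullet> u) * indicator {u. norm u \<le> 1} u"

text \<open>For short jumps the compensator is present and the Taylor remainder applies; for long
  jumps it is switched off and the oscillation 2C remains. The cutoff at 1 is exactly where the
  minimum changes branch.\<close>

lemma jump_bound:
  assumes "tame C f D"
  shows "\<bar>jump f D x u\<bar> \<le> 2 * C * min 1 ((norm u)\<^sup>2)"
proof (cases "norm u \<le> 1")
  case True
  then have "(norm u)\<^sup>2 \<le> 1" by (simp add: power_le_one)
  moreover have "C * (norm u)\<^sup>2 \<ge> 0" using tameD(5)[OF assms] by simp
  ultimately show ?thesis using tameD(4)[OF assms, of x u] True by (simp add: jump_def min_def)
next
  case False
  then have "(norm u)\<^sup>2 \<ge> 1" by simp
  then show ?thesis using False tameD(2)[OF assms, of x] tameD(2)[OF assms, of "x+u"]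
    by (simp add: jump_def min_def)
qed

lemma jump_measurable:
  assumes "tame C f D"
  shows "(\<lambda>p. jump f D (fst p) (snd p)) \<in> borel_measurable (borel \<Otimes>\<^sub>M borel)"
proof -
  note [measurable] = tameD(1)[OF assms] tame_measurable[OF assms]
  show ?thesis unfolding jump_def by measurable
qed

text \<open>The compensated jump of the exponential with frequency \<xi> at the point 0. At a point
  x it is multiplied by the value of the exponential there.\<close>

definition levy_integrand :: "'a::euclidean_space \<Rightarrow> 'a \<Rightarrow> complex" where
  "levy_integrand \<xi> u = iexp (\<xi> \<bullet> u) - 1 - \<i> * of_real ((\<xi> \<bullet> u) * indicator {u. norm u \<le> 1} u)"

lemma levy_integrand_bound: "cmod (levy_integrand \<xi> u) \<le> (2 + (norm \<xi>)\<^sup>2) * min 1 ((norm u)\<^sup>2)"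
proof (cases "norm u \<le> 1")
  case True
  then have u: "min 1 ((norm u)\<^sup>2) = (norm u)\<^sup>2" by (simp add: power_le_one)
  have "cmod (levy_integrand \<xi> u) \<le> \<bar>\<xi> \<bullet> u\<bar>\<^sup>2"
    using iexp_approx1[of "\<xi> \<bullet> u" 1] True zero_le_power2[of "\<xi> \<bullet> u"]
    by (simp add: levy_integrand_def power2_eq_square diff_diff_eq) (smt (verit) norm_ge_zero)
  also have "\<dots> \<le> (norm \<xi> * norm u)\<^sup>2" by (intro power_mono Cauchy_Schwarz_ineq2) auto
  finally show ?thesis using u by (simp add: algebra_simps) (smt (verit) zero_le_power2)
next
  case False
  then have u: "min 1 ((norm u)\<^sup>2) = 1" by (simp add: min_def)
  have "cmod (levy_integrand \<xi> u) \<le> 2"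
    using False norm_triangle_ineq4[of "iexp (\<xi> \<bullet> u)" 1] by (simp add: levy_integrand_def)
  then show ?thesis using u by (simp add: add_increasing2)
qed

lemma levy_integrand_measurable [measurable (raw)]:
  assumes "f \<in> borel_measurable M" "g \<in> borel_measurable M"
  shows "(\<lambda>x. levy_integrand (f x) (g x)) \<in> borel_measurable M"
proof -
  note [measurable] = assms
  show ?thesis unfolding levy_integrand_def by measurable
qed

section \<open>Integration against a Levy measure: generator and exponent\<close>

locale levy =
  fixes b :: "'a::euclidean_space" and \<nu> :: "'a measure"
  assumes levy: "levy_measure \<nu>"
begin

lemma sets_nu [measurable_cong]: "sets \<nu> = sets borel"
  using levy by (simp add: levy_measure_def)

lemma space_nu [simp]: "space \<nu> = UNIV"
  using sets_eq_imp_space_eq[OF sets_nu] by simp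

lemma integrable_min: "integrable \<nu> (\<lambda>u. min 1 ((norm u)\<^sup>2))"
  using levy by (intro integrableI_bounded) (auto simp: levy_measure_def)

text \<open>A Markov inequality for the integrable function \<open>min 1 ((norm u)\<^sup>2)\<close>
  makes its superlevel sets finite. They exhaust everything except 0, which is a null set. This is
  what licenses Fubini and the measurability of integrals over jumps.\<close>

sublocale sigma_finite_measure \<nu>
proof
  let ?k = "\<lambda>u::'a. min 1 ((norm u)\<^sup>2)"
  let ?A = "\<lambda>n::nat. {u::'a. 1 / Suc n \<le> ?k u}"
  have meas: "?A n \<in> sets \<nu>" for n unfolding sets_nu by measurable
  have "emeasure \<nu> (?A n) < \<infinity>" for n
  proof -
    have "emeasure \<nu> (?A n) = (\<integral>\<^sup>+u. indicator (?A n) u \<partial>\<nu>)" using meas by simp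
    also have "\<dots> \<le> (\<integral>\<^sup>+u. ennreal (Suc n) * ennreal (?k u) \<partial>\<nu>)"
    proof (rule nn_integral_mono)
      fix u
      have "u \<in> ?A n \<Longrightarrow> 1 \<le> Suc n * ?k u" 
        using pos_divide_le_eq[of "real (Suc n)" 1 "?k u"] by (simp only: mem_Collect_eq mult.commute of_nat_0_less_iff zero_less_Suc)
      then have "indicator (?A n) u \<le> ennreal (Suc n * ?k u)" by (auto simp: indicator_def simp flip: ennreal_1 intro!: ennreal_leI)
      also have "ennreal (Suc n * ?k u) = ennreal (Suc n) * ennreal (?k u)" by (rule ennreal_mult) auto
      finally show "indicator (?A n) u \<le> ennreal (Suc n) * ennreal (?k u)" .
    qed
    also have "\<dots> = ennreal (Suc n) * (\<integral>\<^sup>+u. ennreal (?k u) \<partial>\<nu>)" by (intro nn_integral_cmult) measurable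
    also have "\<dots> < \<infinity>" using levy unfolding levy_measure_def
      unfolding infinity_ennreal_def ennreal_mult_less_top by simp
    finally show ?thesis .
  qed
  moreover have "emeasure \<nu> {0} < \<infinity>" using levy by (simp add: levy_measure_def)
  moreover have "insert {0} (range ?A) \<subseteq> sets \<nu>"
  proof -
    have "{0} \<in> sets \<nu>" by (simp add: sets_nu)
    then show ?thesis using meas by blast
  qed
  moreover have "\<Union>(insert {0} (range ?A)) = space \<nu>"
  proof -
    have "u \<in> \<Union>(insert {0} (range ?A))" for u
    proof (cases "u = 0")
      case False
      then have "?k u > 0" by simp
      then obtain n where "inverse (Suc n) < ?k u" using reals_Archimedean by blast
      then have "u \<in> ?A n" by (simp add: inverse_eq_divide)
      then show ?thesis by blast
    qed simp
    then show ?thesis by auto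
  qed
  ultimately show "\<exists>A. countable A \<and> A \<subseteq> sets \<nu> \<and> \<Union>A = space \<nu> \<and> (\<forall>a\<in>A. emeasure \<nu> a \<noteq> \<infinity>)"
    by (intro exI[of _ "insert {0} (range ?A)"]) (auto simp: less_top)
qed

text \<open>The generator of the Levy process with drift b, jump measure \<nu> and no Gaussian part.
  The identity under study says that it has the same expectation as <x; \<nabla>f(x)> under the law
  of X.\<close>

definition gen :: "('a \<Rightarrow> real) \<Rightarrow> ('a \<Rightarrow> 'a) \<Rightarrow> 'a \<Rightarrow> real" where
  "gen f D x = b \<bullet> D x + (LINT u|\<nu>. jump f D x u)"

lemma min_integral_nonneg: "0 \<le> (LINT u|\<nu>. min 1 ((norm u)\<^sup>2))"
  by (rule Bochner_Integration.integral_nonneg) simp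

text \<open>The bound of the generator on functions that are tame with constant 1; the factor 2
  comes from \<open>jump_bound\<close>.\<close>

definition gen_norm where "gen_norm = norm b + 2 * (LINT u|\<nu>. min 1 ((norm u)\<^sup>2))"

lemma jump_integrable:
  assumes "tame C f D"
  shows "integrable \<nu> (jump f D x)"
proof (rule Bochner_Integration.integrable_bound)
  show "integrable \<nu> (\<lambda>u. 2 * C * min 1 ((norm u)\<^sup>2))" by (intro integrable_mult_right integrable_min)
  show "AE u in \<nu>. norm (jump f D x u) \<le> norm (2 * C * min 1 ((norm u)\<^sup>2))"
    using jump_bound[OF assms] by (auto intro!: AE_I2 order_trans[OF _ abs_ge_self])
  show "jump f D x \<in> borel_measurable \<nu>"
    using measurable_compose[OF measurable_Pair1'[of x borel borel] jump_measurable[OF assms]]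
    by (simp add: measurable_cong_sets[OF sets_nu refl])
qed

lemma jump_integral_bound:
  assumes "tame C f D"
  shows "\<bar>LINT u|\<nu>. jump f D x u\<bar> \<le> C * (2 * (LINT u|\<nu>. min 1 ((norm u)\<^sup>2)))"
proof -
  have "\<bar>LINT u|\<nu>. jump f D x u\<bar> \<le> (LINT u|\<nu>. 2 * C * min 1 ((norm u)\<^sup>2))"
    unfolding real_norm_def[symmetric]
    by (rule Bochner_Integration.integral_norm_bound_integral[OF jump_integrable[OF assms]])
      (use jump_bound[OF assms] integrable_min in auto)
  then show ?thesis unfolding integral_mult_right_zero by (simp only: mult_ac)
qed

lemma jump_integral_measurable:
  assumes "tame C f D"
  shows "(\<lambda>x. LINT u|\<nu>. jump f D x u) \<in> borel_measurable borel"
proof -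
  have "(\<lambda>p. jump f D (fst p) (snd p)) \<in> borel_measurable (borel \<Otimes>\<^sub>M \<nu>)"
    using jump_measurable[OF assms]
    by (simp add: measurable_cong_sets[OF sets_pair_measure_cong[OF refl sets_nu] refl])
  then show ?thesis
    by (intro borel_measurable_lebesgue_integral) (simp add: case_prod_beta')
qed

lemma gen_bound:
  assumes "tame C f D"
  shows "\<bar>gen f D x\<bar> \<le> C * gen_norm"
proof -
  have "\<bar>b \<bullet> D x\<bar> \<le> norm b * C"
    using Cauchy_Schwarz_ineq2[of b "D x"] mult_left_mono[OF tameD(3)[OF assms, of x] norm_ge_zero[of b]]
    by linarith
  then show ?thesis using jump_integral_bound[OF assms, of x] unfolding gen_def gen_norm_def by (simp add: algebra_simps)
qed

lemma gen_measurable: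
  assumes "tame C f D"
  shows "gen f D \<in> borel_measurable borel"
proof -
  note [measurable] = tameD(1)[OF assms] jump_integral_measurable[OF assms]
  show ?thesis unfolding gen_def[abs_def] by measurable
qed

text \<open>Since C is common to all n, one multiple of \<open>min 1 ((norm u)\<^sup>2)\<close>
  dominates every jump integrand. Pointwise convergence of functions and gradients is then
  enough.\<close>

lemma gen_tendsto:
  assumes t: "\<And>n. tame C (f n) (D n)"
    and f: "\<And>x. (\<lambda>n. f n x) \<longlonglongrightarrow> f' x" and D: "\<And>x. (\<lambda>n. D n x) \<longlonglongrightarrow> D' x"
    and m: "D' \<in> borel_measurable borel"
  shows "(\<lambda>n. gen (f n) (D n) x) \<longlonglongrightarrow> gen f' D' x" 
proof -
  have [measurable]: "f' \<in> borel_measurable borel"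
    by (rule borel_measurable_LIMSEQ_metric[where f=f, OF tame_measurable[OF t] f])
  have "(\<lambda>n. LINT u|\<nu>. jump (f n) (D n) x u) \<longlonglongrightarrow> (LINT u|\<nu>. jump f' D' x u)"
  proof (rule integral_dominated_convergence)
    show "integrable \<nu> (\<lambda>u. 2 * C * min 1 ((norm u)\<^sup>2))" by (intro integrable_mult_right integrable_min)
    show "AE u in \<nu>. (\<lambda>n. jump (f n) (D n) x u) \<longlonglongrightarrow> jump f' D' x u"
      unfolding jump_def by (intro AE_I2 tendsto_intros f D)
    show "AE u in \<nu>. norm (jump (f n) (D n) x u) \<le> 2 * C * min 1 ((norm u)\<^sup>2)" for n
      using jump_bound[OF t] by auto
    show "jump (f n) (D n) x \<in> borel_measurable \<nu>" for n
      using jump_integrable[OF t] by blast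
    show "jump f' D' x \<in> borel_measurable \<nu>" unfolding jump_def by measurable
  qed
  then show ?thesis unfolding gen_def by (intro tendsto_intros D)
qed

definition psi :: "'a \<Rightarrow> complex" where "psi \<xi> = (CLINT u|\<nu>. levy_integrand \<xi> u)"
definition eta :: "'a \<Rightarrow> complex" where "eta \<xi> = \<i> * of_real (b \<bullet> \<xi>) + psi \<xi>"

lemma levy_integrable: "integrable \<nu> (levy_integrand \<xi>)"
proof (rule Bochner_Integration.integrable_bound)
  show "integrable \<nu> (\<lambda>u. (2 + (norm \<xi>)\<^sup>2) * min 1 ((norm u)\<^sup>2))" by (intro integrable_mult_right integrable_min)
  show "AE u in \<nu>. norm (levy_integrand \<xi> u) \<le> norm ((2 + (norm \<xi>)\<^sup>2) * min 1 ((norm u)\<^sup>2))"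
    using levy_integrand_bound[of \<xi>] by (auto intro!: AE_I2 order_trans[OF _ abs_ge_self])
qed measurable

lemma psi_bound: "cmod (psi \<xi>) \<le> (2 + (norm \<xi>)\<^sup>2) * gen_norm"
proof -
  have "cmod (psi \<xi>) \<le> (LINT u|\<nu>. (2 + (norm \<xi>)\<^sup>2) * min 1 ((norm u)\<^sup>2))"
    unfolding psi_def
    by (rule Bochner_Integration.integral_norm_bound_integral[OF levy_integrable])
      (use levy_integrand_bound integrable_min in auto)
  also have "\<dots> = (2 + (norm \<xi>)\<^sup>2) * (LINT u|\<nu>. min 1 ((norm u)\<^sup>2))" by simp
  also have "\<dots> \<le> (2 + (norm \<xi>)\<^sup>2) * gen_norm"
    using min_integral_nonneg unfolding gen_norm_def
    by (intro mult_left_mono) auto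
  finally show ?thesis .
qed

lemma psi_measurable [measurable]: "psi \<in> borel_measurable borel"
  unfolding psi_def[abs_def] by measurable

lemma eta_measurable [measurable]: "eta \<in> borel_measurable borel"
  unfolding eta_def[abs_def] by measurable

text \<open>Drift and jump part are both measured against 2 plus the square of norm \<xi>, hence the
  factor 2. Quadratic growth is what later demands second moments of the mixing measure.\<close>

lemma eta_bound: "cmod (eta \<xi>) \<le> 2 * (2 + (norm \<xi>)\<^sup>2) * gen_norm"
proof -
  have "norm \<xi> \<le> 2 + (norm \<xi>)\<^sup>2"
    using zero_le_power2[of "norm \<xi> - 1"] norm_ge_zero[of \<xi>] unfolding power2_diff by (simp, smt (verit))
  then have "norm b * norm \<xi> \<le> gen_norm * (2 + (norm \<xi>)\<^sup>2)"
    unfolding gen_norm_def using min_integral_nonneg by (intro mult_mono) auto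
  then have "cmod (\<i> * of_real (b \<bullet> \<xi>)) \<le> (2 + (norm \<xi>)\<^sup>2) * gen_norm"
    using Cauchy_Schwarz_ineq2[of b \<xi>] by (simp add: norm_mult mult.commute)
  then show ?thesis using psi_bound[of \<xi>] norm_triangle_ineq[of "\<i> * of_real (b \<bullet> \<xi>)" "psi \<xi>"]
    unfolding eta_def by linarith
qed

text \<open>Exponentials are eigenfunctions of the generator with eigenvalue
  \<open>eta \<xi>\<close>. The real part with a free phase \<theta> keeps the test functions real
  and loses nothing, since varying \<theta> recovers the complex statement.\<close>

lemma gen_cos:
  "gen (\<lambda>x. cos (\<xi> \<bullet> x + \<theta>)) (\<lambda>x. - sin (\<xi> \<bullet> x + \<theta>) *\<^sub>R \<xi>) x = Re (iexp (\<xi> \<bullet> x + \<theta>) * eta \<xi>)"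
proof -
  let ?e = "iexp (\<xi> \<bullet> x + \<theta>)"
  have j: "jump (\<lambda>x. cos (\<xi> \<bullet> x + \<theta>)) (\<lambda>x. - sin (\<xi> \<bullet> x + \<theta>) *\<^sub>R \<xi>) x u = Re (?e * levy_integrand \<xi> u)" for u
    unfolding jump_def levy_integrand_def
    by (simp add: Re_exp Im_exp inner_add_right cos_add sin_add algebra_simps)
  have "(LINT u|\<nu>. jump (\<lambda>x. cos (\<xi> \<bullet> x + \<theta>)) (\<lambda>x. - sin (\<xi> \<bullet> x + \<theta>) *\<^sub>R \<xi>) x u) = Re (?e * psi \<xi>)"
    unfolding j psi_def integral_mult_right_zero[symmetric]
    by (rule integral_Re) (intro integrable_mult_right levy_integrable)
  then show ?thesis
    unfolding gen_def eta_def by (simp add: Re_exp Im_exp algebra_simps)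
qed

end

section \<open>Homogeneity of the exponent\<close>

lemma spherical_part_sets:
  assumes "spherical_part \<nu> \<sigma>"
  shows "(\<lambda>x. x) \<in> borel_measurable \<sigma>" "space \<sigma> = sphere 0 1" "finite_measure \<sigma>"
proof -
  have s: "sets \<sigma> = sets (restrict_space borel (sphere 0 1))"
    using assms by (simp add: spherical_part_def)
  have "(\<lambda>x. x) \<in> borel_measurable (restrict_space borel (sphere 0 1))"
    by (intro measurable_restrict_space1) simp
  then show "(\<lambda>x. x) \<in> borel_measurable \<sigma>" by (simp add: measurable_cong_sets[OF s refl])
  show "space \<sigma> = sphere 0 1" using sets_eq_imp_space_eq[OF s] by (simp add: space_restrict_space)
  show "finite_measure \<sigma>" using assms by (simp add: spherical_part_def)
qed

text \<open>The polar form is given for sets only. Reading it as "\<nu> is the image of a product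
  measure under (x, r) going to r x" transfers it to integrals.\<close>

lemma spherical_part_nn_integral:
  fixes \<nu> \<sigma> :: "'a::euclidean_space measure"
  assumes sp: "spherical_part \<nu> \<sigma>" and nu: "sets \<nu> = sets borel"
    and [measurable]: "h \<in> borel_measurable borel"
  shows "(\<integral>\<^sup>+u. h u \<partial>\<nu>) =
    (\<integral>\<^sup>+x. (\<integral>\<^sup>+r. h (r *\<^sub>R x) * (indicator {0<..} r * ennreal (1 / r\<^sup>2)) \<partial>lborel) \<partial>\<sigma>)"
proof -
  define k where "k r = indicator {0<..} r * ennreal (1 / r\<^sup>2)" for r :: real
  have [measurable]: "k \<in> borel_measurable borel" unfolding k_def by measurable
  define \<rho> where "\<rho> = density lborel k"
  \<comment> \<open>The density 1/r^2 is not integrable at 0, so \<rho> is not finite; being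
    finite-valued it still gives a sigma-finite measure, which is enough for Tonelli.\<close>
  have "sigma_finite_measure \<rho>" unfolding \<rho>_def
    by (subst sigma_finite_measure.sigma_finite_iff_density_finite[OF sigma_finite_lborel]) (auto simp: k_def indicator_def)
  then interpret \<rho>: sigma_finite_measure \<rho> .
  have [measurable_cong]: "sets \<rho> = sets borel" by (simp add: \<rho>_def)
  note [measurable] = spherical_part_sets(1)[OF sp]
  define T where "T p = snd p *\<^sub>R fst p" for p :: "'a \<times> real"
  have T [measurable]: "T \<in> borel_measurable (\<sigma> \<Otimes>\<^sub>M \<rho>)"
    unfolding T_def
    by (intro borel_measurable_scaleR measurable_compose[OF measurable_fst spherical_part_sets(1)[OF sp]]) measurable
  have pair: "(\<integral>\<^sup>+p. g (T p) \<partial>(\<sigma> \<Otimes>\<^sub>M \<rho>)) = (\<integral>\<^sup>+x. (\<integral>\<^sup>+r. g (r *\<^sub>R x) * k r \<partial>lborel) \<partial>\<sigma>)"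
    if [measurable]: "g \<in> borel_measurable borel" for g
    by (subst \<rho>.nn_integral_fst[symmetric])
      (auto simp: T_def \<rho>_def nn_integral_density mult.commute)
  have "\<nu> = distr (\<sigma> \<Otimes>\<^sub>M \<rho>) borel T"
  proof (rule measure_eqI)
    fix B assume "B \<in> sets \<nu>"
    then have B [measurable]: "B \<in> sets borel" by (simp add: nu)
    have "emeasure (distr (\<sigma> \<Otimes>\<^sub>M \<rho>) borel T) B = (\<integral>\<^sup>+p. indicator B p \<partial>distr (\<sigma> \<Otimes>\<^sub>M \<rho>) borel T)" by simp
    also have "\<dots> = (\<integral>\<^sup>+p. indicator B (T p) \<partial>(\<sigma> \<Otimes>\<^sub>M \<rho>))"
      by (rule nn_integral_distr[OF T]) (use B in simp)
    also have "\<dots> = (\<integral>\<^sup>+x. (\<integral>\<^sup>+r. indicator B (r *\<^sub>R x) * k r \<partial>lborel) \<partial>\<sigma>)" by (rule pair) measurable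
    also have "\<dots> = emeasure \<nu> B"
      using sp B by (simp add: spherical_part_def k_def mult_ac)
    finally show "emeasure \<nu> B = emeasure (distr (\<sigma> \<Otimes>\<^sub>M \<rho>) borel T) B" by simp
  qed (simp add: nu)
  then have "(\<integral>\<^sup>+u. h u \<partial>\<nu>) = (\<integral>\<^sup>+p. h (T p) \<partial>(\<sigma> \<Otimes>\<^sub>M \<rho>))"
    by (simp add: nn_integral_distr)
  also have "\<dots> = (\<integral>\<^sup>+x. (\<integral>\<^sup>+r. h (r *\<^sub>R x) * k r \<partial>lborel) \<partial>\<sigma>)" by (rule pair) measurable
  finally show ?thesis by (simp add: k_def)
qed

text \<open>
  Positive and negative part of the integrand have the same, possibly infinite, integral; in
  the infinite case the Bochner integral is \<open>0\<close> by convention.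
\<close>

lemma centered_radial_integral:
  fixes \<nu> \<sigma> :: "'a::euclidean_space measure"
  assumes sp: "spherical_part \<nu> \<sigma>" and nu: "sets \<nu> = sets borel" and cent: "(LINT x|\<sigma>. x) = 0"
    and [measurable]: "g \<in> borel_measurable borel" and g: "\<And>r. 0 \<le> (g r :: real)"
  shows "(LINT u|\<nu>. (\<xi> \<bullet> u) * g (norm u)) = 0"
proof -
  note [measurable] = spherical_part_sets(1)[OF sp]
  define W where "W = (\<integral>\<^sup>+r. ennreal (r * g r) * (indicator {0<..} r * ennreal (1 / r\<^sup>2)) \<partial>lborel)"
  \<comment> \<open>On the unit sphere and for r > 0 the integrand splits into a spherical and a
    radial factor. Having this for every \<zeta> covers the positive part with \<xi> and the
    negative part with -\<xi>, and both share the same W.\<close>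
  have W: "(\<integral>\<^sup>+u. ennreal ((\<zeta> \<bullet> u) * g (norm u)) \<partial>\<nu>) = (\<integral>\<^sup>+x. ennreal (\<zeta> \<bullet> x) \<partial>\<sigma>) * W" for \<zeta> :: 'a
  proof -
    have "(\<integral>\<^sup>+u. ennreal ((\<zeta> \<bullet> u) * g (norm u)) \<partial>\<nu>) = (\<integral>\<^sup>+x. (\<integral>\<^sup>+r. ennreal ((\<zeta> \<bullet> (r *\<^sub>R x)) * g (norm (r *\<^sub>R x))) *
        (indicator {0<..} r * ennreal (1 / r\<^sup>2)) \<partial>lborel) \<partial>\<sigma>)"
      by (rule spherical_part_nn_integral[OF sp nu]) measurable
    also have "\<dots> = (\<integral>\<^sup>+x. ennreal (\<zeta> \<bullet> x) * W \<partial>\<sigma>)"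
    proof (rule nn_integral_cong)
      fix x assume "x \<in> space \<sigma>"
      then have x: "norm x = 1" using spherical_part_sets(2)[OF sp] by simp
      have "ennreal ((\<zeta> \<bullet> (r *\<^sub>R x)) * g (norm (r *\<^sub>R x))) * (indicator {0<..} r * ennreal (1 / r\<^sup>2))
          = ennreal (\<zeta> \<bullet> x) * (ennreal (r * g r) * (indicator {0<..} r * ennreal (1 / r\<^sup>2)))" for r
      proof (cases "r > 0")
        case True
        then have "(\<zeta> \<bullet> (r *\<^sub>R x)) * g (norm (r *\<^sub>R x)) = (\<zeta> \<bullet> x) * (r * g r)" using x by simp
        then show ?thesis using True g[of r] by (simp only: ennreal_mult'' mult_nonneg_nonneg less_imp_le mult.assoc)
      qed simp
      then show "(\<integral>\<^sup>+r. ennreal ((\<zeta> \<bullet> (r *\<^sub>R x)) * g (norm (r *\<^sub>R x))) * (indicator {0<..} r * ennreal (1 / r\<^sup>2)) \<partial>lborel)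
          = ennreal (\<zeta> \<bullet> x) * W"
        unfolding W_def by (simp add: nn_integral_cmult)
    qed
    also have "\<dots> = (\<integral>\<^sup>+x. ennreal (\<zeta> \<bullet> x) \<partial>\<sigma>) * W" by (rule nn_integral_multc) measurable
    finally show ?thesis .
  qed
  interpret \<sigma>: finite_measure \<sigma> using spherical_part_sets(3)[OF sp] .
  have int: "integrable \<sigma> (\<lambda>x. x)"
    by (rule \<sigma>.integrable_const_bound[where B=1]) (use spherical_part_sets(2)[OF sp] in \<open>auto intro!: AE_I2\<close>)
  have "integrable \<sigma> (\<lambda>x. \<xi> \<bullet> x)" using int by (rule integrable_inner_right)
  from real_lebesgue_integral_def[OF this] \<sigma>.integrable_const_bound
  have "enn2real (\<integral>\<^sup>+x. ennreal (\<xi> \<bullet> x) \<partial>\<sigma>) - enn2real (\<integral>\<^sup>+x. ennreal (- (\<xi> \<bullet> x)) \<partial>\<sigma>) = (LINT x|\<sigma>. \<xi> \<bullet> x)"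
    by simp
  also have "\<dots> = 0" using integral_inner_right[of \<xi> \<sigma> "\<lambda>x. x"] int cent by simp
  finally have e: "enn2real (\<integral>\<^sup>+x. ennreal (\<xi> \<bullet> x) \<partial>\<sigma>) = enn2real (\<integral>\<^sup>+x. ennreal ((- \<xi>) \<bullet> x) \<partial>\<sigma>)" by simp
  \<comment> \<open>\<open>enn2real\<close> sends infinity to 0, so the equality of the real values
    lifts back to \<open>ennreal\<close> only after finiteness.\<close>
  have fin: "(\<integral>\<^sup>+x. ennreal (\<zeta> \<bullet> x) \<partial>\<sigma>) < top" for \<zeta> :: 'a
    using integrable_inner_right[OF int, of \<zeta>]
    by (simp only: less_top real_integrable_def infinity_ennreal_def)
  have "(\<integral>\<^sup>+x. ennreal (\<xi> \<bullet> x) \<partial>\<sigma>) = (\<integral>\<^sup>+x. ennreal ((- \<xi>) \<bullet> x) \<partial>\<sigma>)"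
    using arg_cong[OF e, of ennreal] by (simp only: ennreal_enn2real fin)
  then have eq: "(\<integral>\<^sup>+u. ennreal ((\<xi> \<bullet> u) * g (norm u)) \<partial>\<nu>) = (\<integral>\<^sup>+u. ennreal (- ((\<xi> \<bullet> u) * g (norm u))) \<partial>\<nu>)"
    using W[of \<xi>] W[of "- \<xi>"] by simp
  show ?thesis
  proof (cases "integrable \<nu> (\<lambda>u. (\<xi> \<bullet> u) * g (norm u))")
    case True
    then show ?thesis using eq by (simp add: real_lebesgue_integral_def)
  qed (rule not_integrable_integral_eq)
qed

locale levy_index_1 = levy b \<nu> for b :: "'a::euclidean_space" and \<nu> +
  fixes \<sigma> :: "'a measure"
  assumes scaling: "\<And>c::real. c > 0 \<Longrightarrow> \<nu> = scale_measure (ennreal (1 / c)) (dilate_measure c \<nu>)"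
    and polar: "spherical_part \<nu> \<sigma>"
    and centered: "(LINT x|\<sigma>. x) = 0"
begin

text \<open>The scaling of \<nu> permits the substitution of t u for u at the cost of a factor t.
  This moves the truncation from norm u \<le> 1 to t norm u \<le> 1, and the discrepancy is a linear
  function on a shell between two spheres, whose integral vanishes because \<sigma> is
  centered.\<close>

lemma psi_scale:
  assumes t: "t > 0"
  shows "psi (t *\<^sub>R \<xi>) = of_real t * psi \<xi>"
proof -
  define g where "g r = indicator {..1} r - (indicator {..1} (t * r) :: real)" for r :: real
  have [measurable]: "g \<in> borel_measurable borel" unfolding g_def by measurable
  have z: "(LINT u|\<nu>. (\<zeta> \<bullet> u) * g (norm u)) = 0" for \<zeta> :: 'a
  \<comment> \<open>The difference g of the two truncations has one sign, depending on which of the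
    two balls is larger. \<open>max 0\<close> makes nonnegativity immediate for every real argument
    and changes nothing at norms.\<close>
  proof (cases "t \<ge> 1")
    case True
    have "(LINT u|\<nu>. (\<zeta> \<bullet> u) * max 0 (g (norm u))) = 0"
      by (rule centered_radial_integral[OF polar sets_nu centered]) auto
    moreover have "max 0 (g (norm u)) = g (norm u)" for u :: 'a
    proof -
      have "norm u \<le> t * norm u" using True mult_right_mono[of 1 t "norm u"] by simp
      then show ?thesis by (auto simp: g_def indicator_def)
    qed
    ultimately show ?thesis by simp
  next
    case False
    have "(LINT u|\<nu>. (\<zeta> \<bullet> u) * max 0 (- g (norm u))) = 0"
      by (rule centered_radial_integral[OF polar sets_nu centered]) auto
    moreover have "max 0 (- g (norm u)) = - g (norm u)" for u :: 'a
    proof -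
      have "t * norm u \<le> norm u" using False mult_right_mono[of t 1 "norm u"] by simp
      then show ?thesis by (auto simp: g_def indicator_def)
    qed
    ultimately show ?thesis by simp
  qed
  have d: "levy_integrand \<xi> (t *\<^sub>R u) - levy_integrand (t *\<^sub>R \<xi>) u = \<i> * of_real (((t *\<^sub>R \<xi>) \<bullet> u) * g (norm u))" for u
    using t by (simp add: levy_integrand_def g_def indicator_def algebra_simps)
  \<comment> \<open>A constant density expresses the same scaling in a form to which the rules for
    Bochner integrals against a density apply.\<close>
  have sc: "\<nu> = density (distr \<nu> borel (\<lambda>u. t *\<^sub>R u)) (\<lambda>_. ennreal (1 / t))"
  proof (rule measure_eqI)
    show "sets \<nu> = sets (density (distr \<nu> borel (\<lambda>u. t *\<^sub>R u)) (\<lambda>_. ennreal (1 / t)))" by (simp add: sets_nu)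
    fix B assume "B \<in> sets \<nu>"
    then have "B \<in> sets (distr \<nu> borel (\<lambda>u. t *\<^sub>R u))" by (simp add: sets_nu)
    then show "emeasure \<nu> B = emeasure (density (distr \<nu> borel (\<lambda>u. t *\<^sub>R u)) (\<lambda>_. ennreal (1 / t))) B"
      using arg_cong[OF scaling[OF t], of "\<lambda>m. emeasure m B"]
      by (simp add: dilate_measure_def emeasure_density nn_integral_cmult_indicator)
  qed
  have int: "integrable \<nu> (\<lambda>u. levy_integrand \<xi> (t *\<^sub>R u))"
  proof -
    have "integrable (density (distr \<nu> borel (\<lambda>u. t *\<^sub>R u)) (\<lambda>_. ennreal (1 / t))) (levy_integrand \<xi>)"
      using levy_integrable[of \<xi>] sc by simp
    then have "integrable (distr \<nu> borel (\<lambda>u. t *\<^sub>R u)) (\<lambda>u. (1 / t) *\<^sub>R levy_integrand \<xi> u)"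
      using t by (subst (asm) integrable_density) auto
    from integrable_scaleR_right[OF this, of t]
    have "integrable (distr \<nu> borel (\<lambda>u. t *\<^sub>R u)) (levy_integrand \<xi>)"
      using t by simp
    then show ?thesis by (subst (asm) integrable_distr_eq) auto
  qed
  have "psi \<xi> = (CLINT u|density (distr \<nu> borel (\<lambda>u. t *\<^sub>R u)) (\<lambda>_. ennreal (1 / t)). levy_integrand \<xi> u)"
    unfolding psi_def using sc by simp
  also have "\<dots> = (CLINT u|distr \<nu> borel (\<lambda>u. t *\<^sub>R u). (1 / t) *\<^sub>R levy_integrand \<xi> u)"
    using t by (intro integral_density) auto
  also have "\<dots> = (CLINT u|\<nu>. (1 / t) *\<^sub>R levy_integrand \<xi> (t *\<^sub>R u))" by (intro integral_distr) auto
  finally have "of_real t * psi \<xi> = (CLINT u|\<nu>. levy_integrand \<xi> (t *\<^sub>R u))"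
    using t by (simp add: scaleR_conv_of_real)
  also have "\<dots> - psi (t *\<^sub>R \<xi>) = (CLINT u|\<nu>. levy_integrand \<xi> (t *\<^sub>R u) - levy_integrand (t *\<^sub>R \<xi>) u)"
    unfolding psi_def by (rule Bochner_Integration.integral_diff[symmetric, OF int levy_integrable])
  also have "\<dots> = 0" unfolding d using z[of "t *\<^sub>R \<xi>"] by (simp only: integral_mult_right_zero integral_complex_of_real) simp
  finally show ?thesis by simp
qed

lemma eta_scale: "t > 0 \<Longrightarrow> eta (t *\<^sub>R \<xi>) = of_real t * eta \<xi>"
  unfolding eta_def by (simp add: psi_scale algebra_simps)

end

section \<open>The standard Gaussian measure\<close>

text \<open>Lebesgue measure on the space is the image of the product of one-dimensional ones under
  the coordinate map. Values in a normed field let one statement serve both real densities and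
  complex Fourier integrals.\<close>

lemma lborel_prod_Basis:
  fixes k :: "'a::euclidean_space \<Rightarrow> real \<Rightarrow> 'b::{real_normed_field,banach,second_countable_topology}"
  assumes int: "\<And>e. e \<in> Basis \<Longrightarrow> integrable lborel (k e)"
  shows "integrable lborel (\<lambda>x::'a. \<Prod>e\<in>Basis. k e (x \<bullet> e))"
    and "(LINT x::'a|lborel. (\<Prod>e\<in>Basis. k e (x \<bullet> e))) = (\<Prod>e\<in>Basis. LINT x|lborel. k e x)"
proof -
  interpret product_sigma_finite "\<lambda>_::'a. lborel :: real measure" by standard
  let ?T = "\<lambda>f::'a \<Rightarrow> real. \<Sum>e\<in>Basis. f e *\<^sub>R e"
  let ?P = "\<Pi>\<^sub>M e\<in>(Basis :: 'a set). (lborel :: real measure)"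
  have T: "?T \<in> borel_measurable ?P" by measurable
  have [measurable]: "k e \<in> borel_measurable borel" if "e \<in> Basis" for e
    using borel_measurable_integrable[OF int[OF that]] by simp
  have m: "(\<lambda>x::'a. \<Prod>e\<in>Basis. k e (x \<bullet> e)) \<in> borel_measurable borel" by measurable
  have "(\<Prod>e\<in>Basis. k e (?T f \<bullet> e)) = (\<Prod>e\<in>Basis. k e (f e))" for f
    by (intro prod.cong) (simp_all add: inner_sum_left inner_Basis if_distrib cong: if_cong)
  then have eq: "(\<lambda>f. \<Prod>e\<in>Basis. k e (?T f \<bullet> e)) = (\<lambda>f. \<Prod>e\<in>Basis. k e (f e))" by auto
  show "integrable lborel (\<lambda>x::'a. \<Prod>e\<in>Basis. k e (x \<bullet> e))"
    unfolding lborel_eq[where 'a='a] integrable_distr_eq[OF T m] eq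
    by (intro product_integrable_prod int) auto
  show "(LINT x::'a|lborel. (\<Prod>e\<in>Basis. k e (x \<bullet> e))) = (\<Prod>e\<in>Basis. LINT x|lborel. k e x)"
    unfolding lborel_eq[where 'a='a] integral_distr[OF T m] eq
    by (intro product_integral_prod int) auto
qed

text \<open>The product form reduces mass, moments and Fourier transform to one dimension; the
  rotation-invariant form follows in \<open>gauss_density_eq\<close>.\<close>

definition gauss_density :: "'a::euclidean_space \<Rightarrow> real" where
  "gauss_density z = (\<Prod>e\<in>Basis. std_normal_density (z \<bullet> e))"

definition gauss_const :: "'a::euclidean_space itself \<Rightarrow> real" where
  "gauss_const _ = (1 / sqrt (2 * pi)) ^ DIM('a)"

lemma gauss_density_eq:
  "gauss_density (z::'a::euclidean_space) = gauss_const TYPE('a) * exp (- (norm z)\<^sup>2 / 2)"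
proof -
  have "(norm z)\<^sup>2 = (\<Sum>e\<in>Basis. (z \<bullet> e)\<^sup>2)"
    unfolding power2_norm_eq_inner by (subst euclidean_inner) (simp add: power2_eq_square)
  then have "exp (- (norm z)\<^sup>2 / 2) = (\<Prod>e\<in>Basis. exp (- (z \<bullet> e)\<^sup>2 / 2))"
    by (simp add: exp_sum[symmetric] sum_negf sum_divide_distrib)
  then show ?thesis
    unfolding gauss_density_def gauss_const_def std_normal_density_def prod.distrib by simp
qed

lemma gauss_density_nonneg: "0 \<le> gauss_density z"
  unfolding gauss_density_def by (intro prod_nonneg) simp

lemma gauss_density_measurable [measurable]: "gauss_density \<in> borel_measurable borel"
  unfolding gauss_density_def[abs_def] by measurable

lemma gauss_density_integrable: "integrable lborel (gauss_density :: 'a::euclidean_space \<Rightarrow> real)"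
  unfolding gauss_density_def[abs_def]
  by (rule lborel_prod_Basis(1)) simp

lemma gauss_density_integral: "(LINT z|lborel. gauss_density (z::'a::euclidean_space)) = 1"
  unfolding gauss_density_def by (subst lborel_prod_Basis(2)) simp_all

lemma gauss_density_moment2:
  "integrable lborel (\<lambda>z::'a::euclidean_space. (norm z)\<^sup>2 * gauss_density z)"
proof -
  \<comment> \<open>The exponent is 2 in the direction e' and 0 elsewhere, so each factor is a
    standard normal moment and the product rule applies uniformly.\<close>
  have i: "integrable lborel (\<lambda>z::'a. \<Prod>e\<in>Basis. std_normal_density (z \<bullet> e) * (z \<bullet> e) ^ (if e = e' then 2 else 0))" for e'
    by (rule lborel_prod_Basis(1)) (rule integrable_std_normal_moment)
  have eq: "(\<Prod>e\<in>Basis. std_normal_density (z \<bullet> e) * (z \<bullet> e) ^ (if e = e' then 2 else 0)) = (z \<bullet> e')\<^sup>2 * gauss_density z"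
    if "e' \<in> Basis" for e' z :: 'a
  proof -
    have "(\<Prod>e\<in>Basis. (z \<bullet> e) ^ (if e = e' then 2 else 0)) = (\<Prod>e\<in>Basis. if e = e' then (z \<bullet> e)\<^sup>2 else 1)"
      by (rule prod.cong) auto
    also have "\<dots> = (z \<bullet> e')\<^sup>2" using that by (simp add: prod.delta)
    finally show ?thesis unfolding gauss_density_def prod.distrib by simp
  qed
  have "integrable lborel (\<lambda>z::'a. (z \<bullet> e)\<^sup>2 * gauss_density z)" if "e \<in> Basis" for e
    using i[of e] unfolding eq[OF that] .
  then have "integrable lborel (\<lambda>z::'a. \<Sum>e\<in>Basis. (z \<bullet> e)\<^sup>2 * gauss_density z)" by (intro Bochner_Integration.integrable_sum)
  moreover have "(norm z)\<^sup>2 = (\<Sum>e\<in>Basis. (z \<bullet> e)\<^sup>2)" for z :: 'a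
    unfolding power2_norm_eq_inner by (subst euclidean_inner) (simp add: power2_eq_square)
  ultimately show ?thesis by (simp add: sum_distrib_right)
qed

lemma gauss_fourier:
  fixes v :: "'a::euclidean_space"
  shows "(CLINT z|lborel. iexp (v \<bullet> z) * of_real (gauss_density z)) = of_real (exp (- (norm v)\<^sup>2 / 2))"
proof -
  have one: "(CLINT x|lborel. iexp (t * x) * of_real (std_normal_density x)) = of_real (exp (- t\<^sup>2 / 2))" for t
  proof -
    have "(CLINT x|std_normal_distribution. iexp (t * x)) = (CLINT x|lborel. std_normal_density x *\<^sub>R iexp (t * x))"
      by (rule integral_density) auto
    then show ?thesis
      using fun_cong[OF char_std_normal_distribution, of t] by (simp add: char_def scaleR_conv_of_real mult.commute)
  qed
  have "iexp (v \<bullet> z) = (\<Prod>e\<in>Basis. iexp ((v \<bullet> e) * (z \<bullet> e)))" for z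
    by (subst euclidean_inner) (simp add: exp_sum[symmetric] sum_distrib_left)
  then have "iexp (v \<bullet> z) * of_real (gauss_density z)
      = (\<Prod>e\<in>Basis. iexp ((v \<bullet> e) * (z \<bullet> e)) * of_real (std_normal_density (z \<bullet> e)))" for z
    by (simp add: gauss_density_def prod.distrib)
  then have "(CLINT z|lborel. iexp (v \<bullet> z) * of_real (gauss_density z))
     = (CLINT z|lborel. (\<Prod>e\<in>Basis. iexp ((v \<bullet> e) * (z \<bullet> e)) * of_real (std_normal_density (z \<bullet> e))))" by simp
  also have "\<dots> = (\<Prod>e\<in>Basis. (CLINT x|lborel. iexp ((v \<bullet> e) * x) * of_real (std_normal_density x)))"
  proof (rule lborel_prod_Basis(2))
    show "complex_integrable lborel (\<lambda>x. iexp ((v \<bullet> e) * x) * of_real (std_normal_density x))" for e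
      by (rule Bochner_Integration.integrable_bound[of _ std_normal_density])
        (auto simp: norm_mult)
  qed
  also have "\<dots> = of_real (\<Prod>e\<in>Basis. exp (- (v \<bullet> e)\<^sup>2 / 2))" unfolding one by simp
  also have "(\<Prod>e\<in>Basis. exp (- (v \<bullet> e)\<^sup>2 / 2)) = exp (- (norm v)\<^sup>2 / 2)"
  proof -
    have "(norm v)\<^sup>2 = (\<Sum>e\<in>Basis. (v \<bullet> e)\<^sup>2)"
      unfolding power2_norm_eq_inner by (subst euclidean_inner) (simp add: power2_eq_square)
    then show ?thesis by (simp add: exp_sum[symmetric] sum_negf sum_divide_distrib)
  qed
  finally show ?thesis .
qed

definition gauss :: "'a::euclidean_space measure" where "gauss = density lborel gauss_density"

lemma sets_gauss [measurable_cong, simp]: "sets gauss = sets borel" and space_gauss [simp]: "space gauss = UNIV"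
  by (simp_all add: gauss_def)

lemma prob_space_gauss: "prob_space (gauss :: 'a::euclidean_space measure)"
proof
  have "emeasure (gauss :: 'a measure) (space gauss) = (\<integral>\<^sup>+z. ennreal (gauss_density (z::'a)) \<partial>lborel)"
    unfolding gauss_def by (simp add: emeasure_density)
  also have "\<dots> = 1"
    by (subst nn_integral_eq_integral[OF gauss_density_integrable])
      (simp_all add: gauss_density_nonneg gauss_density_integral)
  finally show "emeasure (gauss :: 'a measure) (space gauss) = 1" .
qed

lemma gauss_integrable_norm2: "integrable gauss (\<lambda>z. (norm z)\<^sup>2)"
  unfolding gauss_def using gauss_density_moment2 gauss_density_nonneg
  by (subst integrable_density) (auto simp: mult.commute)

lemma gauss_integrable_norm: "integrable gauss (\<lambda>z::'a::euclidean_space. norm z)"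
proof -
  interpret prob_space "gauss :: 'a measure" by (rule prob_space_gauss)
  show ?thesis
  proof (rule Bochner_Integration.integrable_bound)
    show "integrable gauss (\<lambda>z::'a. 1 + (norm z)\<^sup>2)"
      by (intro Bochner_Integration.integrable_add integrable_const gauss_integrable_norm2)
    have "norm z \<le> 1 + (norm z)\<^sup>2" for z :: 'a
      using zero_le_power2[of "norm z - 1"] norm_ge_zero[of z] unfolding power2_diff by (simp, smt (verit))
    then show "AE z::'a in gauss. norm (norm z) \<le> norm (1 + (norm z)\<^sup>2)" by simp
  qed measurable
qed

text \<open>Up to its normalization the Gaussian is its own Fourier transform. This single instance
  takes the place of an inversion theorem.\<close>

lemma gauss_density_fourier:
  "of_real (gauss_density (v::'a::euclidean_space)) = of_real (gauss_const TYPE('a)) * (CLINT z|gauss. iexp (v \<bullet> z))"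
proof -
  have "(CLINT z|gauss. iexp (v \<bullet> z)) = (CLINT z|lborel. gauss_density z *\<^sub>R iexp (v \<bullet> z))"
    unfolding gauss_def by (rule integral_density) (auto simp: gauss_density_nonneg)
  also have "\<dots> = of_real (exp (- (norm v)\<^sup>2 / 2))"
    using gauss_fourier[of v] by (simp add: scaleR_conv_of_real mult.commute)
  finally show ?thesis by (simp add: gauss_density_eq)
qed

section \<open>Integrability of Schwartz functions\<close>

lemma integrable_rational_Basis:
  "integrable lborel (\<lambda>x::'a::euclidean_space. \<Prod>e\<in>Basis. inverse (1 + (x \<bullet> e)\<^sup>2))"
proof (rule lborel_prod_Basis(1))
  show "integrable lborel (\<lambda>x::real. inverse (1 + x\<^sup>2))"
    using integrable_inverse_1_plus_square by (simp add: set_integrable_def einterval_def)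
qed

text \<open>The majorant is a product of one-dimensional integrable functions, whose reciprocal has
  degree 2d as a polynomial; hence the seminorm of weight 2d. The factor \<open>2 ^ DIM('a)\<close>
  comes from bounding each 1 + |x|^2 by twice a maximum.\<close>

lemma schwartz_integrable:
  fixes f :: "'a::euclidean_space \<Rightarrow> real"
  assumes f: "schwartz_function f"
  shows "integrable lborel f"
proof -
  obtain C where "tame C f (gradient f)" using schwartz_tame[OF f] by blast
  note [measurable] = tame_measurable[OF this]
  obtain B0 where B0: "\<And>x. \<bar>f x\<bar> \<le> B0" using schwartz_bounded[OF f, of "[]" 0] by auto
  obtain B where B: "\<And>x. norm x ^ (2 * DIM('a)) * \<bar>f x\<bar> \<le> B" using schwartz_bounded[OF f, of "[]" "2 * DIM('a)"] by auto
  have bd: "\<bar>f x\<bar> \<le> 2 ^ DIM('a) * (B0 + B) * (\<Prod>e\<in>Basis. inverse (1 + (x \<bullet> e)\<^sup>2))" for x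
  proof -
    have nn: "0 \<le> B0" "0 \<le> B"
      using B0[of 0] order_trans[OF _ B[of 0]] by (auto intro: order_trans[OF abs_ge_zero])
    have "(\<Prod>e\<in>(Basis::'a set). 1 + (x \<bullet> e)\<^sup>2) \<le> (\<Prod>e\<in>(Basis::'a set). 1 + (norm x)\<^sup>2)"
      by (intro prod_mono conjI add_left_mono) (auto simp: abs_le_square_iff[symmetric] Basis_le_norm)
    also have "\<dots> = (1 + (norm x)\<^sup>2) ^ DIM('a)" by simp
    also have "\<dots> \<le> (2 * max 1 ((norm x)\<^sup>2)) ^ DIM('a)" by (intro power_mono) auto
    also have "\<dots> = 2 ^ DIM('a) * max 1 ((norm x) ^ (2 * DIM('a)))"
    proof -
      have "(max 1 y) ^ n = max 1 (y ^ n)" if "y \<ge> 0" for y :: real and n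
        using that by (cases "y \<le> 1") (auto simp: max_absorb1 max_absorb2 power_le_one)
      then show ?thesis by (simp add: power_mult_distrib power_mult)
    qed
    finally have "(\<Prod>e\<in>(Basis::'a set). 1 + (x \<bullet> e)\<^sup>2) * \<bar>f x\<bar> \<le> 2 ^ DIM('a) * max 1 ((norm x) ^ (2 * DIM('a))) * \<bar>f x\<bar>"
      by (intro mult_right_mono) auto
    also have "\<dots> = 2 ^ DIM('a) * (max 1 ((norm x) ^ (2 * DIM('a))) * \<bar>f x\<bar>)" by simp
    also have "\<dots> \<le> 2 ^ DIM('a) * (B0 + B)"
      using B0[of x] B[of x] nn by (intro mult_left_mono) (auto simp: max_def)
    finally have "(\<Prod>e\<in>(Basis::'a set). 1 + (x \<bullet> e)\<^sup>2) * \<bar>f x\<bar> \<le> 2 ^ DIM('a) * (B0 + B)" .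
    moreover have "(\<Prod>e\<in>(Basis::'a set). 1 + (x \<bullet> e)\<^sup>2) > 0" by (intro prod_pos) (auto simp: add_pos_nonneg)
    moreover have "(\<Prod>e\<in>(Basis::'a set). inverse (1 + (x \<bullet> e)\<^sup>2)) = inverse (\<Prod>e\<in>Basis. 1 + (x \<bullet> e)\<^sup>2)"
      using prod_inversef[of "\<lambda>e. 1 + (x \<bullet> e)\<^sup>2" Basis] by (simp add: comp_def)
    ultimately show ?thesis by (simp only: flip: divide_inverse) (simp add: pos_le_divide_eq mult.commute)
  qed
  show ?thesis
    by (rule Bochner_Integration.integrable_bound[OF integrable_mult_right[OF integrable_rational_Basis, of "2 ^ DIM('a) * (B0 + B)"]])
      (auto intro!: AE_I2 order_trans[OF bd abs_ge_self])
qed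

section \<open>Schwartz test functions\<close>

text \<open>A class of prefactors closed under directional derivatives, even after multiplication by
  a Gaussian, whose derivative only contributes a linear factor. The phase in the cosine brings in
  sines without a further rule.\<close>

inductive polytrig :: "('a::euclidean_space \<Rightarrow> real) \<Rightarrow> bool" where
  const: "polytrig (\<lambda>x. c)"
| inner: "polytrig (\<lambda>x. e \<bullet> x)"
| cos: "polytrig (\<lambda>x. cos (\<xi> \<bullet> x + \<theta>))"
| add: "polytrig p \<Longrightarrow> polytrig q \<Longrightarrow> polytrig (\<lambda>x. p x + q x)"
| mult: "polytrig p \<Longrightarrow> polytrig q \<Longrightarrow> polytrig (\<lambda>x. p x * q x)"

lemma polytrig_growth:
  assumes "polytrig p"
  shows "\<exists>C n. 0 \<le> C \<and> (\<forall>x. \<bar>p x\<bar> \<le> C * (1 + norm x) ^ n)"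
  using assms
proof induction
  case (const c)
  show ?case by (intro exI[of _ "\<bar>c\<bar>"] exI[of _ 0]) simp
next
  case (inner e)
  have "\<bar>e \<bullet> x\<bar> \<le> norm e * (1 + norm x) ^ 1" for x
    using Cauchy_Schwarz_ineq2[of e x] by (simp add: distrib_left add_increasing)
  then show ?case using norm_ge_zero by blast
next
  case (cos \<xi> \<theta>)
  show ?case by (intro exI[of _ 1] exI[of _ 0]) simp
next
  case (add p q)
  then obtain C n C' n' where *: "0 \<le> C" "0 \<le> C'" "\<And>x. \<bar>p x\<bar> \<le> C * (1 + norm x) ^ n" "\<And>x. \<bar>q x\<bar> \<le> C' * (1 + norm x) ^ n'"
    by blast
  have "\<bar>p x + q x\<bar> \<le> (C + C') * (1 + norm x) ^ (max n n')" for x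
  proof -
    have "C * (1 + norm x) ^ n \<le> C * (1 + norm x) ^ (max n n')" "C' * (1 + norm x) ^ n' \<le> C' * (1 + norm x) ^ (max n n')"
      using *(1,2) by (auto intro!: mult_left_mono power_increasing)
    then show ?thesis using *(3,4)[of x] by (simp only: distrib_right)
  qed
  then show ?case using *(1,2) add_nonneg_nonneg by blast
next
  case (mult p q)
  then obtain C n C' n' where *: "0 \<le> C" "0 \<le> C'" "\<And>x. \<bar>p x\<bar> \<le> C * (1 + norm x) ^ n" "\<And>x. \<bar>q x\<bar> \<le> C' * (1 + norm x) ^ n'"
    by blast
  have "\<bar>p x * q x\<bar> \<le> (C * C') * (1 + norm x) ^ (n + n')" for x
    using mult_mono'[OF *(3,4)[of x]] by (simp add: abs_mult power_add mult_ac)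
  then show ?case using *(1,2) mult_nonneg_nonneg by blast
qed

lemma polytrig_derivative:
  assumes "polytrig p"
  shows "\<exists>D. (\<forall>h. polytrig (\<lambda>x. D x h)) \<and> (\<forall>x. (p has_derivative D x) (at x))"
  using assms
proof induction
  case (const c)
  show ?case by (intro exI[of _ "\<lambda>x h. 0"]) (auto intro: polytrig.const)
next
  case (inner e)
  show ?case by (intro exI[of _ "\<lambda>x h. e \<bullet> h"]) (auto intro!: polytrig.const derivative_eq_intros)
next
  case (cos \<xi> \<theta>)
  \<comment> \<open>Shifting the phase by a quarter turn keeps the derivative inside the
    class.\<close>
  have s: "sin (\<xi> \<bullet> x + \<theta>) = cos (\<xi> \<bullet> x + (\<theta> - pi / 2))" for x
    by (simp add: add_diff_eq cos_diff)
  have "((\<lambda>x. cos (\<xi> \<bullet> x + \<theta>)) has_derivative (\<lambda>h. (- (\<xi> \<bullet> h)) * cos (\<xi> \<bullet> x + (\<theta> - pi / 2)))) (at x)" for x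
    unfolding s[symmetric] by (auto intro!: derivative_eq_intros)
  moreover have "polytrig (\<lambda>x. (- (\<xi> \<bullet> h)) * cos (\<xi> \<bullet> x + (\<theta> - pi / 2)))" for h
    by (intro polytrig.mult polytrig.const polytrig.cos)
  ultimately show ?case by (intro exI[of _ "\<lambda>x h. (- (\<xi> \<bullet> h)) * cos (\<xi> \<bullet> x + (\<theta> - pi / 2))"]) blast
next
  case (add p q)
  then obtain D E where D: "\<And>h. polytrig (\<lambda>x. D x h)" "\<And>x. (p has_derivative D x) (at x)"
    and E: "\<And>h. polytrig (\<lambda>x. E x h)" "\<And>x. (q has_derivative E x) (at x)"
    by blast
  show ?case
    by (intro exI[of _ "\<lambda>x h. D x h + E x h"] conjI allI polytrig.add D E has_derivative_add)
next
  case (mult p q)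
  then obtain D E where D: "\<And>h. polytrig (\<lambda>x. D x h)" "\<And>x. (p has_derivative D x) (at x)"
    and E: "\<And>h. polytrig (\<lambda>x. E x h)" "\<And>x. (q has_derivative E x) (at x)"
    by blast
  show ?case
    by (intro exI[of _ "\<lambda>x h. p x * E x h + D x h * q x"] conjI allI polytrig.add polytrig.mult mult.hyps D E has_derivative_mult)
qed

lemma gauss_dominates_power:
  assumes a: "a > 0"
  obtains B where "\<And>r::real. r \<ge> 0 \<Longrightarrow> (1 + r) ^ n * exp (- a * r\<^sup>2) \<le> B"
proof -
  \<comment> \<open>The exponent is shared among the n factors 1 + r, each of which is beaten by its
    own Gaussian. Dividing by n + 1 rather than n covers n = 0.\<close>
  define c where "c = a / (n + 1)"
  have c: "c > 0" using a by (simp add: c_def)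
  have nc: "n * c \<le> a" using a by (simp add: c_def divide_simps)
  have "(1 + r) ^ n * exp (- a * r\<^sup>2) \<le> (2 + 1 / c) ^ n" if r: "r \<ge> 0" for r
  proof -
    have "1 + r \<le> 2 + r\<^sup>2"
      using zero_le_power2[of "r - 1"] r unfolding power2_diff by simp
    also have "\<dots> \<le> (2 + 1 / c) * (1 + c * r\<^sup>2)" using c by (simp add: algebra_simps)
    also have "\<dots> \<le> (2 + 1 / c) * exp (c * r\<^sup>2)" using c by (intro mult_left_mono exp_ge_add_one_self) auto
    finally have 1: "(1 + r) * exp (- c * r\<^sup>2) \<le> 2 + 1 / c"
      by (simp add: exp_minus divide_simps)
    have "exp (- a * r\<^sup>2) \<le> exp (- (n * c) * r\<^sup>2)" using nc by (simp add: mult_right_mono)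
    also have "\<dots> = exp (- c * r\<^sup>2) ^ n" by (simp add: exp_of_nat_mult[symmetric])
    finally have "(1 + r) ^ n * exp (- a * r\<^sup>2) \<le> (1 + r) ^ n * exp (- c * r\<^sup>2) ^ n"
      using r by (intro mult_left_mono) auto
    also have "\<dots> = ((1 + r) * exp (- c * r\<^sup>2)) ^ n" by (simp add: power_mult_distrib)
    also have "\<dots> \<le> (2 + 1 / c) ^ n" using r by (intro power_mono 1) auto
    finally show ?thesis .
  qed
  then show ?thesis using that by blast
qed

lemma has_derivative_gauss:
  fixes x :: "'a::euclidean_space"
  shows "((\<lambda>x. exp (- a * (norm x)\<^sup>2)) has_derivative (\<lambda>h. (- 2 * a * exp (- a * (norm x)\<^sup>2)) * (x \<bullet> h))) (at x)"
  unfolding power2_norm_eq_inner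
  by (auto intro!: derivative_eq_intros simp: inner_commute algebra_simps)

lemma schwartz_polytrig_gauss:
  fixes p :: "'a::euclidean_space \<Rightarrow> real"
  assumes p: "polytrig p" and a: "a > 0"
  shows "schwartz_function (\<lambda>x. p x * exp (- a * (norm x)\<^sup>2))"
proof -
  let ?G = "\<lambda>x::'a. exp (- a * (norm x)\<^sup>2)"
  have step: "\<exists>D. (\<forall>h. polytrig (\<lambda>x. D x h)) \<and> (\<forall>x. ((\<lambda>x. q x * ?G x) has_derivative (\<lambda>h. D x h * ?G x)) (at x))"
    if q: "polytrig q" for q :: "'a \<Rightarrow> real"
  proof -
    obtain D where D: "\<And>h. polytrig (\<lambda>x. D x h)" "\<And>x. (q has_derivative D x) (at x)"
      using polytrig_derivative[OF q] by blast
    have "polytrig (\<lambda>x. D x h + (- 2 * a) * ((h \<bullet> x) * q x))" for h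
      by (intro polytrig.add D polytrig.mult polytrig.const polytrig.inner q)
    moreover have "((\<lambda>x. q x * ?G x) has_derivative (\<lambda>h. (D x h + (- 2 * a) * ((h \<bullet> x) * q x)) * ?G x)) (at x)" for x
      by (rule has_derivative_eq_rhs[OF has_derivative_mult[OF D(2) has_derivative_gauss]])
        (simp add: algebra_simps inner_commute)
    ultimately show ?thesis by (intro exI[of _ "\<lambda>x h. D x h + (- 2 * a) * ((h \<bullet> x) * q x)"]) blast
  qed
  have iter: "\<exists>q. polytrig q \<and> iterated_partial es (\<lambda>x. p x * ?G x) = (\<lambda>x. q x * ?G x)" for es
  proof (induction es)
    case Nil
    then show ?case using p by auto
  next
    case (Cons e es)
    then obtain q where q: "polytrig q" "iterated_partial es (\<lambda>x. p x * ?G x) = (\<lambda>x. q x * ?G x)" by blast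
    obtain D where D: "\<And>h. polytrig (\<lambda>x. D x h)"
      "\<And>x. ((\<lambda>x. q x * ?G x) has_derivative (\<lambda>h. D x h * ?G x)) (at x)" using step[OF q(1)] by blast
    have "iterated_partial (e # es) (\<lambda>x. p x * ?G x) = (\<lambda>x. D x e * ?G x)"
      unfolding iterated_partial.simps q(2) by (simp only: frechet_derivative_at[OF D(2), symmetric])
    then show ?case using D(1) by blast
  qed
  show ?thesis unfolding schwartz_function_def
  proof (intro allI impI conjI)
    fix es :: "'a list" and k :: nat
    obtain q where q: "polytrig q" "iterated_partial es (\<lambda>x. p x * ?G x) = (\<lambda>x. q x * ?G x)" using iter by blast
    show "iterated_partial es (\<lambda>x. p x * ?G x) differentiable_on UNIV"
      using step[OF q(1)] unfolding q(2) differentiable_on_def differentiable_def by blast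
    obtain C n where C: "0 \<le> C" "\<And>x. \<bar>q x\<bar> \<le> C * (1 + norm x) ^ n" using polytrig_growth[OF q(1)] by blast
    obtain B where B: "\<And>r::real. r \<ge> 0 \<Longrightarrow> (1 + r) ^ (k + n) * exp (- a * r\<^sup>2) \<le> B"
      using gauss_dominates_power[OF a] by blast
    have "norm (norm x ^ k * (q x * ?G x)) \<le> C * B" for x
    proof -
      have "norm (norm x ^ k * (q x * ?G x)) = norm x ^ k * \<bar>q x\<bar> * ?G x" by (simp add: abs_mult)
      also have "\<dots> \<le> ((1 + norm x) ^ k * (C * (1 + norm x) ^ n)) * ?G x"
        using C by (intro mult_right_mono mult_mono power_mono) auto
      also have "\<dots> = C * ((1 + norm x) ^ (k + n) * ?G x)" by (simp add: power_add mult_ac)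
      also have "\<dots> \<le> C * B" using C(1) by (intro mult_left_mono B) auto
      finally show ?thesis .
    qed
    then show "bounded (range (\<lambda>x. norm x ^ k * iterated_partial es (\<lambda>x. p x * ?G x) x))"
      unfolding q(2) bounded_iff by blast
  qed
qed

lemma schwartz_cos_gauss:
  fixes \<xi> :: "'a::euclidean_space"
  shows "a > 0 \<Longrightarrow> schwartz_function (\<lambda>x. cos (\<xi> \<bullet> x + \<theta>) * exp (- a * (norm x)\<^sup>2))"
  by (intro schwartz_polytrig_gauss polytrig.cos)

section \<open>From the identity to stability\<close>

text \<open>The first bound controls the error caused by differentiating the Gaussian cutoff,
  uniformly in its width. The second makes the damped factor <\<xi>;x> bounded for each fixed
  width.\<close>

lemma exp_neg_bounds:
  fixes y :: "'a::real_normed_vector"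
  shows "(norm y)\<^sup>2 * exp (- (1/2) * (norm y)\<^sup>2) \<le> 2" "norm y * exp (- (1/2) * (norm y)\<^sup>2) \<le> 1"
proof -
  have e: "1 + (norm y)\<^sup>2 / 2 \<le> exp ((norm y)\<^sup>2 / 2)" by (rule exp_ge_add_one_self)
  then have "(norm y)\<^sup>2 \<le> 2 * exp ((norm y)\<^sup>2 / 2)" by linarith
  then show "(norm y)\<^sup>2 * exp (- (1/2) * (norm y)\<^sup>2) \<le> 2" by (simp add: exp_minus divide_simps)
  have "norm y \<le> 1 + (norm y)\<^sup>2 / 2"
    using zero_le_power2[of "norm y - 1"] unfolding power2_diff by simp
  with e show "norm y * exp (- (1/2) * (norm y)\<^sup>2) \<le> 1" by (simp add: exp_minus divide_simps)
qed

text \<open>The phases 0 and \<open>- (pi / 2)\<close> read off real and imaginary part. Real test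
  functions with a free phase thus yield complex identities.\<close>

lemma complex_eqI_rotations:
  assumes "\<And>\<theta>. Re (iexp \<theta> * z) = Re (iexp \<theta> * w)"
  shows "z = w"
proof (rule complex_eqI)
  show "Re z = Re w" using assms[of 0] by simp
  show "Im z = Im w" using assms[of "- (pi / 2)"] by (simp add: Re_exp Im_exp)
qed

locale levy_vector = levy_index_1 b \<nu> \<sigma> + prob_space M
  for b :: "'a::euclidean_space" and \<nu> \<sigma> and M :: "'w measure" +
  fixes X :: "'w \<Rightarrow> 'a"
  assumes X [measurable]: "X \<in> borel_measurable M"
begin

definition stein :: "('a \<Rightarrow> real) \<Rightarrow> bool" where
  "stein f \<longleftrightarrow> (LINT \<omega>|M. X \<omega> \<bullet> gradient f (X \<omega>)) =
            (LINT \<omega>|M. b \<bullet> gradient f (X \<omega>)) +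
            (LINT \<omega>|M. (LINT u|\<nu>. f (X \<omega> + u) - f (X \<omega>)
               - (gradient f (X \<omega>) \<bullet> u) * indicator {u. norm u \<le> 1} u))"

text \<open>For tame f the drift and the jump term are bounded functions of X, so their expectations
  may be merged into one.\<close>

lemma stein_iff_gen:
  assumes t: "tame C f (gradient f)"
  shows "stein f \<longleftrightarrow> (LINT \<omega>|M. X \<omega> \<bullet> gradient f (X \<omega>)) = (LINT \<omega>|M. gen f (gradient f) (X \<omega>))"
proof -
  note [measurable] = tameD(1)[OF t] jump_integral_measurable[OF t]
  have "integrable M (\<lambda>\<omega>. b \<bullet> gradient f (X \<omega>))"
    by (rule integrable_const_bound[where B="norm b * C"])
      (auto intro!: AE_I2 order_trans[OF Cauchy_Schwarz_ineq2] mult_left_mono tameD(3)[OF t])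
  moreover have "integrable M (\<lambda>\<omega>. LINT u|\<nu>. jump f (gradient f) (X \<omega>) u)"
    by (rule integrable_const_bound) (use jump_integral_bound[OF t] in auto)
  ultimately show ?thesis
    unfolding stein_def gen_def jump_def[symmetric] by (subst Bochner_Integration.integral_add) auto
qed

lemma integral_abs_le_const:
  fixes f :: "'w \<Rightarrow> real"
  assumes "integrable M f" "\<And>\<omega>. \<bar>f \<omega>\<bar> \<le> C"
  shows "\<bar>LINT \<omega>|M. f \<omega>\<bar> \<le> C"
  by (rule order_trans[OF integral_abs_bound integral_le_const[OF integrable_abs[OF assms(1)]]])
    (simp add: assms(2))

lemma char_fun_integrable: "integrable M (\<lambda>\<omega>. iexp (\<xi> \<bullet> X \<omega>))"
  by (rule integrable_const_bound[where B=1]) auto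

lemma char_fun_bound: "cmod (char_fun M X \<xi>) \<le> 1"
  unfolding char_fun_def
  by (rule order_trans[OF integral_norm_bound]) (simp add: prob_space)

lemma char_fun_line_continuous: "isCont (\<lambda>\<tau>. char_fun M X (\<tau> *\<^sub>R \<xi>)) \<tau>"
  unfolding continuous_at_sequentially comp_def char_fun_def
proof (intro allI impI)
  fix s assume s: "s \<longlonglongrightarrow> \<tau>"
  show "(\<lambda>n. CLINT \<omega>|M. iexp (s n *\<^sub>R \<xi> \<bullet> X \<omega>)) \<longlonglongrightarrow> (CLINT \<omega>|M. iexp (\<tau> *\<^sub>R \<xi> \<bullet> X \<omega>))"
    by (rule integral_dominated_convergence[where w="\<lambda>_. 1"]) (auto intro!: AE_I2 tendsto_intros s)
qed

lemma integral_cos_eq: "(LINT \<omega>|M. cos (\<xi> \<bullet> X \<omega> + \<theta>)) = Re (iexp \<theta> * char_fun M X \<xi>)"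
proof -
  have "(LINT \<omega>|M. cos (\<xi> \<bullet> X \<omega> + \<theta>)) = (LINT \<omega>|M. Re (iexp \<theta> * iexp (\<xi> \<bullet> X \<omega>)))"
    by (intro Bochner_Integration.integral_cong) (auto simp: Re_exp Im_exp cos_add algebra_simps)
  also have "\<dots> = Re (CLINT \<omega>|M. iexp \<theta> * iexp (\<xi> \<bullet> X \<omega>))"
    by (rule integral_Re) (intro integrable_mult_right char_fun_integrable)
  finally show ?thesis by (simp add: char_fun_def)
qed

lemma integral_gen_cos:
  "(LINT \<omega>|M. gen (\<lambda>x. cos (\<xi> \<bullet> x + \<theta>)) (\<lambda>x. - sin (\<xi> \<bullet> x + \<theta>) *\<^sub>R \<xi>) (X \<omega>))
    = Re (iexp \<theta> * (eta \<xi> * char_fun M X \<xi>))"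
proof -
  have "(LINT \<omega>|M. Re (iexp (\<xi> \<bullet> X \<omega> + \<theta>) * eta \<xi>)) = (LINT \<omega>|M. Re ((iexp \<theta> * eta \<xi>) * iexp (\<xi> \<bullet> X \<omega>)))"
    by (intro Bochner_Integration.integral_cong) (auto simp: exp_add distrib_left mult_ac)
  also have "\<dots> = Re (CLINT \<omega>|M. (iexp \<theta> * eta \<xi>) * iexp (\<xi> \<bullet> X \<omega>))"
    by (rule integral_Re) (intro integrable_mult_right char_fun_integrable)
  finally show ?thesis unfolding gen_cos by (simp add: char_fun_def mult.assoc)
qed

text \<open>The integrated form is chosen because \<phi> cannot be differentiated under the
  expectation: <\<xi>;X> need not be integrable. The damped derivative \<open>a n \<tau>\<close> is
  evaluated twice as the cutoff is flattened, once through the identity, which gives the right side,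
  and once through Fubini and the fundamental theorem of calculus, which gives the left
  side.\<close>

lemma stein_imp_char_fun_ode:
  assumes stein: "\<And>f. schwartz_function f \<Longrightarrow> stein f" and s: "0 < s" "s \<le> T"
  shows "char_fun M X (T *\<^sub>R \<xi>) - char_fun M X (s *\<^sub>R \<xi>)
    = (CLINT \<tau>|restrict_space lborel {s..T}. eta \<xi> * char_fun M X (\<tau> *\<^sub>R \<xi>))"
proof (rule complex_eqI_rotations)
  fix \<theta> :: real
  let ?\<phi> = "\<lambda>\<tau>. char_fun M X (\<tau> *\<^sub>R \<xi>)"
  define R where "R = restrict_space lborel {s..T}"
  have sR: "space R = {s..T}" by (simp add: R_def space_restrict_space)
  have [measurable]: "(\<lambda>x. x) \<in> borel_measurable R"
    unfolding R_def by (intro measurable_restrict_space1) simp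
  interpret R: finite_measure R
    by standard (simp add: sR, simp add: R_def emeasure_restrict_space emeasure_lborel_Icc[OF s(2)])
  interpret MR: pair_sigma_finite M R ..
  interpret MRf: finite_measure "M \<Otimes>\<^sub>M R" 
    by (intro finite_measure_pair_measure finite_measure_axioms R.finite_measure_axioms)
  define G :: "'a \<Rightarrow> real" where "G x = exp (- (1/2) * (norm x)\<^sup>2)" for x
  have [measurable]: "G \<in> borel_measurable borel" unfolding G_def by measurable
  have G01: "0 \<le> G x" "G x \<le> 1" for x by (simp_all add: G_def)
  have "schwartz_function G"
    using schwartz_cos_gauss[of "1/2" 0 0] by (simp add: G_def[abs_def])
  then obtain A where A: "tame A G (gradient G)" using schwartz_tame by blast
  have gG: "gradient G x = - G x *\<^sub>R x" for x
    unfolding G_def by (rule gradient_eqI) (use has_derivative_gauss[of "1/2" x] in simp)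
  define c where "c n = 1 / real (Suc n)" for n
  have c: "0 < c n" "c n \<le> 1" for n by (simp_all add: c_def)
  have c0: "c \<longlonglongrightarrow> 0" unfolding c_def using LIMSEQ_inverse_real_of_nat by (simp add: inverse_eq_divide)
  define f where "f n \<tau> x = cos ((\<tau> *\<^sub>R \<xi>) \<bullet> x + \<theta>) * G (c n *\<^sub>R x)" for n \<tau> x
  define D where "D n \<tau> x = G (c n *\<^sub>R x) *\<^sub>R (- sin ((\<tau> *\<^sub>R \<xi>) \<bullet> x + \<theta>) *\<^sub>R (\<tau> *\<^sub>R \<xi>))
    + cos ((\<tau> *\<^sub>R \<xi>) \<bullet> x + \<theta>) *\<^sub>R (c n *\<^sub>R gradient G (c n *\<^sub>R x))" for n \<tau> x
  define B where "B \<tau> = 4 * (1 + (norm (\<tau> *\<^sub>R \<xi>))\<^sup>2) * A" for \<tau>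
  have t: "tame (B \<tau>) (f n \<tau>) (D n \<tau>)" for n \<tau>
    unfolding f_def D_def B_def by (intro tame_mult tame_cos tame_scale A) (use c[of n] in simp)
  have gf: "gradient (f n \<tau>) = D n \<tau>" for n \<tau>
    using gradient_eqI[OF tame_has_derivative[OF t]] by blast
  have "f n \<tau> = (\<lambda>x. cos ((\<tau> *\<^sub>R \<xi>) \<bullet> x + \<theta>) * exp (- ((c n)\<^sup>2 / 2) * (norm x)\<^sup>2))" for n \<tau>
    by (simp add: f_def G_def power_mult_distrib fun_eq_iff)
  then have sf: "schwartz_function (f n \<tau>)" for n \<tau>
    using schwartz_cos_gauss[of "(c n)\<^sup>2 / 2" "\<tau> *\<^sub>R \<xi>" \<theta>] c(1)[of n] by simp
  \<comment> \<open>Splitting <x; \<nabla>f(x)> by the product rule: \<open>a\<close> carries the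
    \<tau>-derivative of the cosine, \<open>r\<close> the gradient of the cutoff, and
    \<open>E\<close> is the generator side.\<close>
  define a where "a n \<tau> = (LINT \<omega>|M. - (\<xi> \<bullet> X \<omega>) * sin (\<tau> * (\<xi> \<bullet> X \<omega>) + \<theta>) * G (c n *\<^sub>R X \<omega>))" for n \<tau>
  define r where "r n \<tau> = (LINT \<omega>|M. cos (\<tau> * (\<xi> \<bullet> X \<omega>) + \<theta>) * ((norm (c n *\<^sub>R X \<omega>))\<^sup>2 * G (c n *\<^sub>R X \<omega>)))" for n \<tau>
  define E where "E n \<tau> = (LINT \<omega>|M. gen (f n \<tau>) (D n \<tau>) (X \<omega>))" for n \<tau>
  \<comment> \<open>This bound explodes with n; it serves only integrability and Fubini for fixed n.
    The bound uniform in n is \<open>aS\<close>.\<close>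
  have abound: "\<bar>- (\<xi> \<bullet> x) * sin (\<tau> * (\<xi> \<bullet> x) + \<theta>) * G (c n *\<^sub>R x)\<bar> \<le> norm \<xi> / c n" for n \<tau> x
  proof -
    have "\<bar>- (\<xi> \<bullet> x) * sin (\<tau> * (\<xi> \<bullet> x) + \<theta>) * G (c n *\<^sub>R x)\<bar> \<le> ((norm \<xi> * norm x) * 1) * G (c n *\<^sub>R x)"
      unfolding abs_mult abs_minus_cancel using G01[of "c n *\<^sub>R x"]
      by (intro mult_mono Cauchy_Schwarz_ineq2) auto
    also have "\<dots> = norm \<xi> / c n * (norm (c n *\<^sub>R x) * G (c n *\<^sub>R x))" using c(1)[of n] by simp
    also have "\<dots> \<le> norm \<xi> / c n * 1"
      unfolding G_def using c(1)[of n] by (intro mult_left_mono exp_neg_bounds) auto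
    finally show ?thesis by simp
  qed
  have rbound: "\<bar>cos y * ((norm (c n *\<^sub>R x))\<^sup>2 * G (c n *\<^sub>R x))\<bar> \<le> 2" for n y x
  proof -
    have "\<bar>cos y * ((norm (c n *\<^sub>R x))\<^sup>2 * G (c n *\<^sub>R x))\<bar> \<le> 1 * \<bar>(norm (c n *\<^sub>R x))\<^sup>2 * G (c n *\<^sub>R x)\<bar>"
      unfolding abs_mult[of "cos y"] by (intro mult_right_mono) auto
    also have "\<dots> \<le> 2" using exp_neg_bounds(1)[of "c n *\<^sub>R x"] by (simp add: G_def abs_mult)
    finally show ?thesis .
  qed
  have aint: "integrable M (\<lambda>\<omega>. - (\<xi> \<bullet> X \<omega>) * sin (\<tau> * (\<xi> \<bullet> X \<omega>) + \<theta>) * G (c n *\<^sub>R X \<omega>))" for n \<tau>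
    by (rule integrable_const_bound[where B="norm \<xi> / c n"]) (use abound in auto)
  have rint: "integrable M (\<lambda>\<omega>. cos (\<tau> * (\<xi> \<bullet> X \<omega>) + \<theta>) * ((norm (c n *\<^sub>R X \<omega>))\<^sup>2 * G (c n *\<^sub>R X \<omega>)))" for n \<tau>
    by (rule integrable_const_bound[where B=2]) (use rbound in auto)
  have id: "\<tau> * a n \<tau> - r n \<tau> = E n \<tau>" for n \<tau>
  proof -
    have "x \<bullet> D n \<tau> x = \<tau> * (- (\<xi> \<bullet> x) * sin (\<tau> * (\<xi> \<bullet> x) + \<theta>) * G (c n *\<^sub>R x))
        - cos (\<tau> * (\<xi> \<bullet> x) + \<theta>) * ((norm (c n *\<^sub>R x))\<^sup>2 * G (c n *\<^sub>R x))" for x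
      unfolding D_def gG
      by (simp add: inner_add_right inner_commute[of x \<xi>] power2_norm_eq_inner power_mult_distrib)
        (simp add: power2_eq_square inner_diff_right inner_commute[of x \<xi>])
    then have "(LINT \<omega>|M. X \<omega> \<bullet> D n \<tau> (X \<omega>)) = \<tau> * a n \<tau> - r n \<tau>"
      unfolding a_def r_def using aint[of \<tau> n] rint[of \<tau> n] by simp
    then show ?thesis
      using stein_iff_gen[of "B \<tau>" "f n \<tau>"] t[of \<tau> n] stein[OF sf, of n \<tau>] unfolding gf E_def by simp
  qed
  have cX: "(\<lambda>n. c n *\<^sub>R x) \<longlonglongrightarrow> 0" for x :: 'a using tendsto_scaleR[OF c0 tendsto_const[of x]] by simp
  have Gc: "isCont G x" for x unfolding G_def by (intro continuous_intros)
  have GX: "(\<lambda>n. G (c n *\<^sub>R x)) \<longlonglongrightarrow> 1" for x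
    using isCont_tendsto_compose[OF Gc cX[of x]] by (simp add: G_def)
  have r0: "(\<lambda>n. r n \<tau>) \<longlonglongrightarrow> 0" for \<tau>
  proof -
    have "(\<lambda>n. r n \<tau>) \<longlonglongrightarrow> (LINT \<omega>|M. 0)"
      unfolding r_def
    proof (rule integral_dominated_convergence[where w="\<lambda>_. 2"])
      show "AE \<omega> in M. (\<lambda>n. cos (\<tau> * (\<xi> \<bullet> X \<omega>) + \<theta>) * ((norm (c n *\<^sub>R X \<omega>))\<^sup>2 * G (c n *\<^sub>R X \<omega>))) \<longlonglongrightarrow> 0"
      proof (intro AE_I2)
        fix \<omega>
        have "(\<lambda>n. cos (\<tau> * (\<xi> \<bullet> X \<omega>) + \<theta>) * ((norm (c n *\<^sub>R X \<omega>))\<^sup>2 * G (c n *\<^sub>R X \<omega>)))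
          \<longlonglongrightarrow> cos (\<tau> * (\<xi> \<bullet> X \<omega>) + \<theta>) * ((norm (0::'a))\<^sup>2 * 1)"
          by (intro tendsto_intros cX GX)
        then show "(\<lambda>n. cos (\<tau> * (\<xi> \<bullet> X \<omega>) + \<theta>) * ((norm (c n *\<^sub>R X \<omega>))\<^sup>2 * G (c n *\<^sub>R X \<omega>))) \<longlonglongrightarrow> 0" by simp
      qed
    qed (use rbound in auto)
    then show ?thesis by simp
  qed
  have E0: "(\<lambda>n. E n \<tau>) \<longlonglongrightarrow> Re (iexp \<theta> * (eta (\<tau> *\<^sub>R \<xi>) * ?\<phi> \<tau>))" for \<tau>
    unfolding E_def integral_gen_cos[symmetric]
  proof (rule integral_dominated_convergence[where w="\<lambda>_. B \<tau> * gen_norm"])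
    show "AE \<omega> in M. (\<lambda>n. gen (f n \<tau>) (D n \<tau>) (X \<omega>)) \<longlonglongrightarrow>
      gen (\<lambda>x. cos ((\<tau> *\<^sub>R \<xi>) \<bullet> x + \<theta>)) (\<lambda>x. - sin ((\<tau> *\<^sub>R \<xi>) \<bullet> x + \<theta>) *\<^sub>R (\<tau> *\<^sub>R \<xi>)) (X \<omega>)"
    proof (intro AE_I2 gen_tendsto[OF t])
      fix x
      have "(\<lambda>n. cos ((\<tau> *\<^sub>R \<xi>) \<bullet> x + \<theta>) * G (c n *\<^sub>R x)) \<longlonglongrightarrow> cos ((\<tau> *\<^sub>R \<xi>) \<bullet> x + \<theta>) * 1"
        by (intro tendsto_intros GX)
      then show "(\<lambda>n. f n \<tau> x) \<longlonglongrightarrow> cos ((\<tau> *\<^sub>R \<xi>) \<bullet> x + \<theta>)" by (simp add: f_def)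
      have "(\<lambda>n. D n \<tau> x) \<longlonglongrightarrow> 1 *\<^sub>R (- sin ((\<tau> *\<^sub>R \<xi>) \<bullet> x + \<theta>) *\<^sub>R (\<tau> *\<^sub>R \<xi>))
          + cos ((\<tau> *\<^sub>R \<xi>) \<bullet> x + \<theta>) *\<^sub>R (0 *\<^sub>R (- 1 *\<^sub>R 0))"
        unfolding D_def gG by (intro tendsto_intros GX cX c0)
      then show "(\<lambda>n. D n \<tau> x) \<longlonglongrightarrow> - sin ((\<tau> *\<^sub>R \<xi>) \<bullet> x + \<theta>) *\<^sub>R (\<tau> *\<^sub>R \<xi>)" by simp
    qed (use tameD(1)[OF tame_cos] in auto)
    show "AE \<omega> in M. norm (gen (f n \<tau>) (D n \<tau>) (X \<omega>)) \<le> B \<tau> * gen_norm" for n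
      using gen_bound[OF t] by auto
    show "(\<lambda>\<omega>. gen (f n \<tau>) (D n \<tau>) (X \<omega>)) \<in> borel_measurable M" for n
      using measurable_compose[OF X gen_measurable[OF t]] .
    show "(\<lambda>\<omega>. gen (\<lambda>x. cos ((\<tau> *\<^sub>R \<xi>) \<bullet> x + \<theta>)) (\<lambda>x. - sin ((\<tau> *\<^sub>R \<xi>) \<bullet> x + \<theta>) *\<^sub>R (\<tau> *\<^sub>R \<xi>)) (X \<omega>)) \<in> borel_measurable M"
      using measurable_compose[OF X gen_measurable[OF tame_cos]] .
  qed simp
  \<comment> \<open>Homogeneity enters here: the eigenvalue at \<tau>\<xi> is \<tau> times the one
    at \<xi>, and this \<tau> cancels the one in front of \<open>a n \<tau>\<close>.\<close>
  have a0: "(\<lambda>n. a n \<tau>) \<longlonglongrightarrow> Re (iexp \<theta> * (eta \<xi> * ?\<phi> \<tau>))" if "\<tau> > 0" for \<tau>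
  proof -
    have "(\<lambda>n. (E n \<tau> + r n \<tau>) / \<tau>) \<longlonglongrightarrow> (Re (iexp \<theta> * (eta (\<tau> *\<^sub>R \<xi>) * ?\<phi> \<tau>)) + 0) / \<tau>"
      using that by (intro tendsto_intros E0 r0) auto
    moreover have "(E n \<tau> + r n \<tau>) / \<tau> = a n \<tau>" for n using id[of \<tau> n] that by (simp add: field_simps)
    moreover have "iexp \<theta> * (eta (\<tau> *\<^sub>R \<xi>) * ?\<phi> \<tau>) = of_real \<tau> * (iexp \<theta> * (eta \<xi> * ?\<phi> \<tau>))"
      unfolding eta_scale[OF that] by (simp only: mult_ac)
    ultimately show ?thesis using that by simp
  qed
  \<comment> \<open>From the identity, \<tau> times \<open>a n \<tau>\<close> equals
    \<open>E + r\<close>, where \<open>E\<close> is at most \<open>B T * gen_norm\<close> and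
    \<open>r\<close> at most 2. Dividing needs \<tau> \<ge> s > 0.\<close>
  define S where "S = (B T * gen_norm + 2) / s"
  have aS: "\<bar>a n \<tau>\<bar> \<le> S" if "\<tau> \<in> {s..T}" for n \<tau>
  proof -
    have 1: "\<bar>r n \<tau>\<bar> \<le> 2"
      unfolding r_def by (rule integral_abs_le_const[OF rint rbound])
    have "\<bar>E n \<tau>\<bar> \<le> B \<tau> * gen_norm"
      unfolding E_def
    proof (rule integral_abs_le_const[OF _ gen_bound[OF t]])
      show "integrable M (\<lambda>\<omega>. gen (f n \<tau>) (D n \<tau>) (X \<omega>))"
        by (rule integrable_const_bound[where B="B \<tau> * gen_norm"])
          (use gen_bound[OF t] measurable_compose[OF X gen_measurable[OF t]] in auto)
    qed
    also have "\<dots> \<le> B T * gen_norm"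
    proof (rule mult_right_mono)
      have "norm (\<tau> *\<^sub>R \<xi>) \<le> norm (T *\<^sub>R \<xi>)" using that s by (simp add: mult_right_mono)
      then show "B \<tau> \<le> B T" unfolding B_def using tameD(5)[OF A] by (intro mult_right_mono mult_left_mono add_left_mono power_mono) auto
      show "gen_norm \<ge> 0" unfolding gen_norm_def using min_integral_nonneg by simp
    qed
    finally have "\<bar>E n \<tau> + r n \<tau>\<bar> \<le> B T * gen_norm + 2" using 1 by linarith
    moreover have "E n \<tau> + r n \<tau> = \<tau> * a n \<tau>" using id[of \<tau> n] by simp
    moreover have "s * \<bar>a n \<tau>\<bar> \<le> \<bar>\<tau> * a n \<tau>\<bar>" using that s unfolding abs_mult by (intro mult_right_mono) auto
    ultimately have "s * \<bar>a n \<tau>\<bar> \<le> B T * gen_norm + 2" by simp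
    then show ?thesis using s by (simp add: S_def pos_le_divide_eq mult.commute)
  qed
  have [measurable]: "(\<lambda>\<tau>. ?\<phi> \<tau>) \<in> borel_measurable R"
  proof -
    have "?\<phi> \<in> borel_measurable borel"
      by (intro borel_measurable_continuous_onI continuous_at_imp_continuous_on ballI char_fun_line_continuous)
    then show ?thesis unfolding R_def by (intro measurable_restrict_space1) simp
  qed
  have am [measurable]: "a n \<in> borel_measurable R" for n
    unfolding a_def by measurable
  have "(\<lambda>n. LINT \<tau>|R. a n \<tau>) \<longlonglongrightarrow> (LINT \<tau>|R. Re (iexp \<theta> * (eta \<xi> * ?\<phi> \<tau>)))"
  proof (rule integral_dominated_convergence[where w="\<lambda>_. S"])
    show "AE \<tau> in R. (\<lambda>n. a n \<tau>) \<longlonglongrightarrow> Re (iexp \<theta> * (eta \<xi> * ?\<phi> \<tau>))"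
      using a0 s by (intro AE_I2) (simp add: sR)
    show "AE \<tau> in R. norm (a n \<tau>) \<le> S" for n using aS by (intro AE_I2) (simp add: sR)
  qed auto
  moreover have "(LINT \<tau>|R. a n \<tau>) = (LINT \<omega>|M. (cos ((T *\<^sub>R \<xi>) \<bullet> X \<omega> + \<theta>) - cos ((s *\<^sub>R \<xi>) \<bullet> X \<omega> + \<theta>)) * G (c n *\<^sub>R X \<omega>))" for n
  proof -
    \<comment> \<open>For each outcome the integrand is an exact \<tau>-derivative times a factor
      free of \<tau>. Integrating over \<tau> first removes the unbounded factor <\<xi>;X>.\<close>
    have "(LINT \<tau>|R. a n \<tau>) = (LINT \<omega>|M. (LINT \<tau>|R. - (\<xi> \<bullet> X \<omega>) * sin (\<tau> * (\<xi> \<bullet> X \<omega>) + \<theta>) * G (c n *\<^sub>R X \<omega>)))"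
      unfolding a_def
    proof (rule MR.Fubini_integral)
      have "(\<lambda>p. - (\<xi> \<bullet> X (fst p)) * sin (snd p * (\<xi> \<bullet> X (fst p)) + \<theta>) * G (c n *\<^sub>R X (fst p))) \<in> borel_measurable (M \<Otimes>\<^sub>M R)"
        by measurable
      then show "integrable (M \<Otimes>\<^sub>M R) (\<lambda>(\<omega>, \<tau>). - (\<xi> \<bullet> X \<omega>) * sin (\<tau> * (\<xi> \<bullet> X \<omega>) + \<theta>) * G (c n *\<^sub>R X \<omega>))"
        by (intro MRf.integrable_const_bound[where B="norm \<xi> / c n"]) (use abound in \<open>auto simp: case_prod_beta'\<close>)
    qed
    also have "\<dots> = (LINT \<omega>|M. (cos ((T *\<^sub>R \<xi>) \<bullet> X \<omega> + \<theta>) - cos ((s *\<^sub>R \<xi>) \<bullet> X \<omega> + \<theta>)) * G (c n *\<^sub>R X \<omega>))"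
    proof (rule Bochner_Integration.integral_cong[OF refl])
      fix \<omega>
      let ?y = "\<xi> \<bullet> X \<omega>"
      have "(LINT \<tau>|R. - ?y * sin (\<tau> * ?y + \<theta>)) = (LBINT \<tau>. indicator {s..T} \<tau> *\<^sub>R (- ?y * sin (\<tau> * ?y + \<theta>)))"
        unfolding R_def by (subst integral_restrict_space) auto
      also have "\<dots> = cos (T * ?y + \<theta>) - cos (s * ?y + \<theta>)"
        by (rule integral_FTC_Icc[OF s(2)])
          (auto intro!: derivative_eq_intros continuous_intros simp flip: has_real_derivative_iff_has_vector_derivative)
      finally show "(LINT \<tau>|R. - ?y * sin (\<tau> * ?y + \<theta>) * G (c n *\<^sub>R X \<omega>)) = (cos ((T *\<^sub>R \<xi>) \<bullet> X \<omega> + \<theta>) - cos ((s *\<^sub>R \<xi>) \<bullet> X \<omega> + \<theta>)) * G (c n *\<^sub>R X \<omega>)"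
        unfolding integral_mult_left_zero by simp
    qed
    finally show ?thesis .
  qed
  moreover have "(\<lambda>n. LINT \<omega>|M. (cos ((T *\<^sub>R \<xi>) \<bullet> X \<omega> + \<theta>) - cos ((s *\<^sub>R \<xi>) \<bullet> X \<omega> + \<theta>)) * G (c n *\<^sub>R X \<omega>))
    \<longlonglongrightarrow> (LINT \<omega>|M. (cos ((T *\<^sub>R \<xi>) \<bullet> X \<omega> + \<theta>) - cos ((s *\<^sub>R \<xi>) \<bullet> X \<omega> + \<theta>)) * 1)"
  proof (rule integral_dominated_convergence[where w="\<lambda>_. 2"])
    show "AE \<omega> in M. (\<lambda>n. (cos ((T *\<^sub>R \<xi>) \<bullet> X \<omega> + \<theta>) - cos ((s *\<^sub>R \<xi>) \<bullet> X \<omega> + \<theta>)) * G (c n *\<^sub>R X \<omega>))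
      \<longlonglongrightarrow> (cos ((T *\<^sub>R \<xi>) \<bullet> X \<omega> + \<theta>) - cos ((s *\<^sub>R \<xi>) \<bullet> X \<omega> + \<theta>)) * 1"
      by (intro AE_I2 tendsto_intros GX)
    have "\<bar>(cos y - cos z) * G x\<bar> \<le> 2 * 1" for y z x
    proof -
      have "\<bar>cos y - cos z\<bar> \<le> 2"
        using abs_triangle_ineq4[of "cos y" "cos z"] abs_cos_le_one[of y] abs_cos_le_one[of z] by linarith
      then show ?thesis unfolding abs_mult using G01[of x] by (intro mult_mono) auto
    qed
    then show "AE \<omega> in M. norm ((cos ((T *\<^sub>R \<xi>) \<bullet> X \<omega> + \<theta>) - cos ((s *\<^sub>R \<xi>) \<bullet> X \<omega> + \<theta>)) * G (c n *\<^sub>R X \<omega>)) \<le> 2" for n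
      by simp
  qed auto
  ultimately have "(LINT \<tau>|R. Re (iexp \<theta> * (eta \<xi> * ?\<phi> \<tau>))) = (LINT \<omega>|M. (cos ((T *\<^sub>R \<xi>) \<bullet> X \<omega> + \<theta>) - cos ((s *\<^sub>R \<xi>) \<bullet> X \<omega> + \<theta>)))"
    using LIMSEQ_unique by fastforce
  also have "\<dots> = (LINT \<omega>|M. cos ((T *\<^sub>R \<xi>) \<bullet> X \<omega> + \<theta>)) - (LINT \<omega>|M. cos ((s *\<^sub>R \<xi>) \<bullet> X \<omega> + \<theta>))"
    by (rule Bochner_Integration.integral_diff) (auto intro!: integrable_const_bound[where B=1])
  also have "\<dots> = Re (iexp \<theta> * (?\<phi> T - ?\<phi> s))" unfolding integral_cos_eq by (simp add: algebra_simps)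
  finally have "Re (iexp \<theta> * (?\<phi> T - ?\<phi> s)) = (LINT \<tau>|R. Re (iexp \<theta> * (eta \<xi> * ?\<phi> \<tau>)))" ..
  also have "\<dots> = Re (CLINT \<tau>|R. iexp \<theta> * (eta \<xi> * ?\<phi> \<tau>))"
  proof (rule integral_Re, intro integrable_mult_right)
    show "integrable R ?\<phi>" by (rule R.integrable_const_bound[where B=1]) (use char_fun_bound in auto)
  qed
  finally show "Re (iexp \<theta> * (?\<phi> T - ?\<phi> s)) = Re (iexp \<theta> * (CLINT \<tau>|restrict_space lborel {s..T}. eta \<xi> * ?\<phi> \<tau>))"
    by (simp only: integral_mult_right_zero R_def)
qed

end

section \<open>Solving the equation along rays\<close>

context levy_vector begin

text \<open>Multiplying by the integrating factor exp(-\<tau>\<eta>) turns the solution along the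
  ray into a function \<open>q\<close> constant on (0, 1]. Its value is its limit at 0, where \<phi>
  equals 1.\<close>

lemma stein_imp_stable:
  assumes stein: "\<And>f. schwartz_function f \<Longrightarrow> stein f"
  shows "char_fun M X \<xi> = exp (eta \<xi>)"
proof -
  define p where "p \<tau> = char_fun M X (\<tau> *\<^sub>R \<xi>)" for \<tau>
  have cont: "continuous_on A p" for A
    unfolding p_def using char_fun_line_continuous by (simp add: continuous_at_imp_continuous_on)
  have ode: "p T = p s + integral {s..T} (\<lambda>\<tau>. eta \<xi> * p \<tau>)" if s: "0 < s" "s \<le> T" for s T
  proof -
    have c: "continuous_on {s..T} (\<lambda>\<tau>. eta \<xi> * p \<tau>)" by (intro continuous_intros cont)
    have "(CLINT \<tau>|restrict_space lborel {s..T}. eta \<xi> * p \<tau>) = (CLINT \<tau>:{s..T}|lborel. eta \<xi> * p \<tau>)"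
      unfolding set_lebesgue_integral_def by (subst integral_restrict_space) auto
    also have "\<dots> = integral {s..T} (\<lambda>\<tau>. eta \<xi> * p \<tau>)"
      by (rule set_borel_integral_eq_integral(2)) (rule borel_integrable_atLeastAtMost'[OF c])
    finally show ?thesis using stein_imp_char_fun_ode[OF stein s, of \<xi>] unfolding p_def by (simp add: algebra_simps)
  qed
  define q where "q \<tau> = p \<tau> * exp (- (of_real \<tau> * eta \<xi>))" for \<tau> :: real
  have eq: "q 1 = q s" if s: "0 < s" "s \<le> 1" for s
  proof -
    have pd: "(p has_vector_derivative eta \<xi> * p \<tau>) (at \<tau> within {s..1})" if \<tau>: "\<tau> \<in> {s..1}" for \<tau>
    proof -
      \<comment> \<open>Differentiability of \<open>p\<close> is gained here: the integrand is
        continuous, so the integral equation exhibits \<open>p\<close> as a primitive.\<close>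
      have "((\<lambda>T. integral {s..T} (\<lambda>\<tau>. eta \<xi> * p \<tau>)) has_vector_derivative eta \<xi> * p \<tau>) (at \<tau> within {s..1})"
        by (rule integral_has_vector_derivative[OF _ \<tau>]) (intro continuous_intros cont)
      from has_vector_derivative_add[OF has_vector_derivative_const this]
      have "((\<lambda>T. p s + integral {s..T} (\<lambda>\<tau>. eta \<xi> * p \<tau>)) has_vector_derivative eta \<xi> * p \<tau>) (at \<tau> within {s..1})"
        by simp
      then show ?thesis
        by (rule has_vector_derivative_transform[OF \<tau> ode[OF s(1)], rotated]) simp
    qed
    have "(q has_vector_derivative 0) (at \<tau> within {s..1})" if \<tau>: "\<tau> \<in> {s..1}" for \<tau>
    proof -
      have "((\<lambda>\<tau>. exp (- (of_real \<tau> * eta \<xi>))) has_vector_derivative (- eta \<xi>) * exp (- (of_real \<tau> * eta \<xi>))) (at \<tau> within {s..1})"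
        by (auto intro!: derivative_eq_intros has_vector_derivative_real_field)
      from has_vector_derivative_mult[OF pd[OF \<tau>] this] show ?thesis
        unfolding q_def by (simp add: algebra_simps)
    qed
    then obtain k where "\<And>\<tau>. \<tau> \<in> {s..1} \<Longrightarrow> q \<tau> = k"
      using has_vector_derivative_zero_constant[of "{s..1}" q] by auto
    then show ?thesis using s by auto
  qed
  \<comment> \<open>The equation is known only for positive \<tau>; continuity closes the gap at the
    origin.\<close>
  have "isCont q 0"
    unfolding q_def p_def by (intro continuous_intros char_fun_line_continuous)
  moreover have "(\<lambda>n. 1 / real (Suc n)) \<longlonglongrightarrow> 0"
    using LIMSEQ_inverse_real_of_nat by (simp add: inverse_eq_divide)
  ultimately have "(\<lambda>n. q (1 / real (Suc n))) \<longlonglongrightarrow> q 0" by (rule isCont_tendsto_compose)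
  moreover have "q (1 / real (Suc n)) = q 1" for n by (rule eq[symmetric]) auto
  ultimately have "q 1 = q 0" by (simp add: LIMSEQ_const_iff)
  then have "char_fun M X \<xi> * exp (- eta \<xi>) = 1"
    by (simp add: q_def p_def char_fun_def prob_space)
  then show ?thesis by (simp add: exp_minus divide_simps flip: divide_inverse)
qed

end

section \<open>From stability to the identity\<close>

lemma exp_quotient_tendsto:
  "(\<lambda>n. (exp (of_real (1 / real (Suc n)) * z) - 1) / of_real (1 / real (Suc n))) \<longlonglongrightarrow> (z :: complex)"
proof -
  have "((\<lambda>t. exp (t * z)) has_field_derivative z) (at 0)" by (auto intro!: derivative_eq_intros)
  then have l: "((\<lambda>t. (exp (t * z) - 1) / t) \<longlongrightarrow> z) (at 0)" by (simp add: has_field_derivative_iff)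
  have "(\<lambda>n. of_real (1 / real (Suc n)) :: complex) \<longlonglongrightarrow> of_real 0"
    using LIMSEQ_inverse_real_of_nat by (intro tendsto_of_real) (simp add: inverse_eq_divide)
  then have "filterlim (\<lambda>n. of_real (1 / real (Suc n)) :: complex) (at 0) sequentially"
    by (intro filterlim_atI always_eventually) (auto simp: of_nat_Suc[symmetric] simp del: of_nat_Suc)
  from filterlim_compose[OF l this] show ?thesis .
qed

text \<open>On the closed left half-plane, which is convex, the derivative of \<open>exp\<close> has
  modulus at most 1. This covers both purely imaginary exponents and the values of
  \<open>eta\<close>.\<close>

lemma exp_quotient_bound:
  assumes "Re z \<le> 0" "0 < s"
  shows "cmod ((exp (of_real s * z) - 1) / of_real s) \<le> cmod z"
proof -
  have "cmod (exp (of_real s * z) - exp 0) \<le> 1 * cmod (of_real s * z - 0)"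
  proof (rule field_differentiable_bound[where S="{z. Re z \<le> 0}"])
    show "(exp has_field_derivative exp w) (at w within {z. Re z \<le> 0})" for w :: complex
      by (auto intro!: derivative_eq_intros)
  qed (use assms in \<open>auto simp: convex_halfspace_Re_le mult_nonneg_nonpos\<close>)
  then show ?thesis using assms by (simp add: norm_divide norm_mult divide_simps mult.commute)
qed

lemma tame_quotient_tendsto:
  assumes "tame C f D"
  shows "(\<lambda>n. (f (x + (1 / real (Suc n)) *\<^sub>R v) - f x) / (1 / real (Suc n))) \<longlonglongrightarrow> D x \<bullet> v"
proof -
  let ?s = "\<lambda>n. 1 / real (Suc n)"
  have lim: "(\<lambda>n. C * (norm v)\<^sup>2 * ?s n) \<longlonglongrightarrow> 0"
    using LIMSEQ_inverse_real_of_nat by (intro tendsto_mult_right_zero) (simp add: inverse_eq_divide)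
  have le: "norm ((f (x + ?s n *\<^sub>R v) - f x) / ?s n - D x \<bullet> v) \<le> C * (norm v)\<^sup>2 * ?s n" for n
  proof -
    have s: "?s n > 0" by simp
    have "norm ((f (x + ?s n *\<^sub>R v) - f x) / ?s n - D x \<bullet> v)
      = \<bar>f (x + ?s n *\<^sub>R v) - f x - D x \<bullet> (?s n *\<^sub>R v)\<bar> / ?s n"
      using s by (simp add: field_simps abs_divide[symmetric] del: of_nat_Suc)
    also have "\<dots> \<le> (C * (norm (?s n *\<^sub>R v))\<^sup>2) / ?s n"
      using s by (intro divide_right_mono tameD(4)[OF assms]) auto
    also have "\<dots> = C * (norm v)\<^sup>2 * ?s n" by (simp add: power2_eq_square)
    finally show ?thesis .
  qed
  have "(\<lambda>n. (f (x + ?s n *\<^sub>R v) - f x) / ?s n - D x \<bullet> v) \<longlonglongrightarrow> 0"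
    by (rule Lim_null_comparison[OF always_eventually[OF allI[OF le]] lim])
  then show ?thesis by (rule LIM_zero_cancel)
qed

lemma (in pair_sigma_finite) integrable_times:
  fixes f :: "'a \<Rightarrow> real" and g :: "'b \<Rightarrow> real"
  assumes f: "integrable M1 f" and g: "integrable M2 g"
  shows "integrable (M1 \<Otimes>\<^sub>M M2) (\<lambda>(x, y). f x * g y)"
proof (rule Fubini_integrable)
  have [measurable]: "f \<in> borel_measurable M1" "g \<in> borel_measurable M2" using f g by auto
  show "(\<lambda>(x, y). f x * g y) \<in> borel_measurable (M1 \<Otimes>\<^sub>M M2)" by measurable
  show "integrable M1 (\<lambda>x. LINT y|M2. norm (case (x, y) of (x, y) \<Rightarrow> f x * g y))"
    using f by (simp add: abs_mult)
  show "AE x in M1. integrable M2 (\<lambda>y. case (x, y) of (x, y) \<Rightarrow> f x * g y)"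
    using g by simp
qed

text \<open>The mean value point r x lies farther out than x because the increment points outwards.
  So norm x is at most norm (r x), and the decay of the gradient at r x gives a bound independent of
  x.\<close>

lemma radial_increment_bound:
  assumes t: "tame C f D" and d: "\<And>x. norm x * norm (D x) \<le> C" and s: "0 < s"
  shows "\<bar>(f (x + s *\<^sub>R x) - f x) / s\<bar> \<le> C"
proof -
  have "((\<lambda>r. f (r *\<^sub>R x)) has_real_derivative D (r *\<^sub>R x) \<bullet> x) (at r)" for r
    unfolding has_field_derivative_def
    by (rule has_derivative_eq_rhs[OF has_derivative_compose[OF _ tame_has_derivative[OF t]]])
      (auto intro!: derivative_eq_intros simp: fun_eq_iff)
  then obtain r where r: "1 < r" "f ((1 + s) *\<^sub>R x) - f (1 *\<^sub>R x) = (1 + s - 1) * (D (r *\<^sub>R x) \<bullet> x)"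
    using MVT2[of 1 "1 + s" "\<lambda>r. f (r *\<^sub>R x)" "\<lambda>r. D (r *\<^sub>R x) \<bullet> x"] s by auto
  then have "(f (x + s *\<^sub>R x) - f x) / s = D (r *\<^sub>R x) \<bullet> x" using s by (simp add: algebra_simps)
  also have "\<bar>\<dots>\<bar> \<le> norm x * norm (D (r *\<^sub>R x))"
    using Cauchy_Schwarz_ineq2[of "D (r *\<^sub>R x)" x] by (simp add: mult.commute)
  also have "\<dots> \<le> norm (r *\<^sub>R x) * norm (D (r *\<^sub>R x))"
    using r(1) by (intro mult_right_mono) (auto simp: mult_le_cancel_right1)
  also have "\<dots> \<le> C" by (rule d)
  finally show ?thesis .
qed

context levy_vector begin

text \<open>
  The Fourier representation of \<open>h\<close> is differentiated under \<open>Q\<close>, and its values are real, so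
  the gradient \<open>D\<close> is identified by uniqueness of limits of difference quotients.
\<close>

lemma stein_mixture:
  fixes Q :: "'q measure" and Z :: "'q \<Rightarrow> 'a" and w :: "'q \<Rightarrow> complex"
  assumes stable: "\<And>\<xi>. char_fun M X \<xi> = exp (eta \<xi>)"
    and Q: "finite_measure Q" and Z [measurable]: "Z \<in> borel_measurable Q"
    and Z2: "integrable Q (\<lambda>z. (norm (Z z))\<^sup>2)"
    and w [measurable]: "w \<in> borel_measurable Q" and W: "\<And>z. cmod (w z) \<le> W"
    and t: "tame C h D" and d: "\<And>x. norm x * norm (D x) \<le> C"
    and rep: "\<And>x. of_real (h x) = (CLINT z|Q. w z * iexp (Z z \<bullet> x))"
  shows "(LINT \<omega>|M. X \<omega> \<bullet> D (X \<omega>)) = (LINT \<omega>|M. gen h D (X \<omega>))"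
proof -
  interpret Q: finite_measure Q by (rule Q)
  interpret QN: pair_sigma_finite Q \<nu> ..
  interpret NQ: pair_sigma_finite \<nu> Q ..
  interpret MQ: pair_sigma_finite M Q ..
  let ?s = "\<lambda>n. 1 / real (Suc n)"
  have W0: "0 \<le> W" using W[of undefined] norm_ge_zero order_trans by blast
  \<comment> \<open>One majorant for everything below: 2 plus the square of the norm dominates
    constants, first powers and the growth of \<open>psi\<close> and \<open>eta\<close>.\<close>
  have int2: "integrable Q (\<lambda>z. W * (2 + (norm (Z z))\<^sup>2))"
    by (intro integrable_mult_right Bochner_Integration.integrable_add Z2) simp
  have int_eta: "integrable Q (\<lambda>z. W * (2 * (2 + (norm (Z z))\<^sup>2) * gen_norm))"
  proof -
    have "W * (2 * q * gen_norm) = 2 * gen_norm * (W * q)" for q by simp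
    then show ?thesis by (simp only: integrable_mult_right[OF int2])
  qed
  have int_bd: "integrable Q k"
    if "k \<in> borel_measurable Q" "\<And>z. cmod (k z) \<le> W * (2 + (norm (Z z))\<^sup>2) * B" for k :: "'q \<Rightarrow> complex" and B :: real
    by (rule Bochner_Integration.integrable_bound[OF integrable_mult_left[OF int2, of B] that(1)])
      (use that(2) in \<open>auto intro!: AE_I2 order_trans[OF _ abs_ge_self]\<close>)
  have w_le: "cmod (w z * k) \<le> W * B" if "cmod k \<le> B" for k B z
    unfolding norm_mult using W[of z] that W0 by (intro mult_mono) auto
  have n1: "norm (Z z) \<le> 2 + (norm (Z z))\<^sup>2" for z
    using zero_le_power2[of "norm (Z z) - 1"] norm_ge_zero[of "Z z"] unfolding power2_diff by (simp, smt (verit))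
  have i0: "integrable Q (\<lambda>z. w z * iexp (Z z \<bullet> x))" for x
    by (rule Q.integrable_const_bound[where B="W * 1"], intro AE_I2 w_le, simp, measurable)
  have zv: "cmod (\<i> * of_real (Z z \<bullet> v)) \<le> (2 + (norm (Z z))\<^sup>2) * norm v" for z v
    using order_trans[OF Cauchy_Schwarz_ineq2[of "Z z" v] mult_right_mono[OF n1[of z] norm_ge_zero[of v]]]
    by (simp add: norm_mult)
  have i1: "integrable Q (\<lambda>z. w z * (\<i> * of_real (Z z \<bullet> v) * iexp (Z z \<bullet> x)))" for x v
  proof (rule int_bd[of _ "norm v"])
    show "cmod (w z * (\<i> * of_real (Z z \<bullet> v) * iexp (Z z \<bullet> x))) \<le> W * (2 + (norm (Z z))\<^sup>2) * norm v" for z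
      unfolding mult.assoc[of W] by (rule w_le) (use zv[of z v] in \<open>simp add: norm_mult\<close>)
  qed measurable
  have grad: "of_real (D x \<bullet> v) = (CLINT z|Q. w z * (\<i> * of_real (Z z \<bullet> v) * iexp (Z z \<bullet> x)))" for x v
  proof (rule LIMSEQ_unique)
    show "(\<lambda>n. complex_of_real ((h (x + ?s n *\<^sub>R v) - h x) / ?s n)) \<longlonglongrightarrow> of_real (D x \<bullet> v)"
      by (intro tendsto_of_real tame_quotient_tendsto[OF t])
    have "(\<lambda>n. CLINT z|Q. w z * ((exp (of_real (?s n) * (\<i> * of_real (Z z \<bullet> v))) - 1) / of_real (?s n) * iexp (Z z \<bullet> x)))
      \<longlonglongrightarrow> (CLINT z|Q. w z * (\<i> * of_real (Z z \<bullet> v) * iexp (Z z \<bullet> x)))"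
    proof (rule integral_dominated_convergence)
      show "integrable Q (\<lambda>z. W * (2 + (norm (Z z))\<^sup>2) * norm v)" using int2 by (rule integrable_mult_left)
      show "AE z in Q. (\<lambda>n. w z * ((exp (of_real (?s n) * (\<i> * of_real (Z z \<bullet> v))) - 1) / of_real (?s n) * iexp (Z z \<bullet> x)))
          \<longlonglongrightarrow> w z * (\<i> * of_real (Z z \<bullet> v) * iexp (Z z \<bullet> x))"
        by (intro AE_I2 tendsto_mult tendsto_const exp_quotient_tendsto)
      show "AE z in Q. norm (w z * ((exp (of_real (?s n) * (\<i> * of_real (Z z \<bullet> v))) - 1) / of_real (?s n) * iexp (Z z \<bullet> x)))
          \<le> W * (2 + (norm (Z z))\<^sup>2) * norm v" for n
      proof (intro AE_I2)
        fix z
        have "cmod ((exp (of_real (?s n) * (\<i> * of_real (Z z \<bullet> v))) - 1) / of_real (?s n)) \<le> (2 + (norm (Z z))\<^sup>2) * norm v"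
          by (rule order_trans[OF exp_quotient_bound zv]) simp_all
        then show "norm (w z * ((exp (of_real (?s n) * (\<i> * of_real (Z z \<bullet> v))) - 1) / of_real (?s n) * iexp (Z z \<bullet> x)))
          \<le> W * (2 + (norm (Z z))\<^sup>2) * norm v"
          unfolding mult.assoc[of W] by (intro w_le) (simp only: norm_mult norm_exp_i_times mult_1_right)
      qed
    qed measurable
    moreover have "(CLINT z|Q. w z * ((exp (of_real (?s n) * (\<i> * of_real (Z z \<bullet> v))) - 1) / of_real (?s n) * iexp (Z z \<bullet> x)))
      = complex_of_real ((h (x + ?s n *\<^sub>R v) - h x) / ?s n)" for n
    proof -
      have eq: "w z * ((exp (of_real (?s n) * (\<i> * of_real (Z z \<bullet> v))) - 1) / of_real (?s n) * iexp (Z z \<bullet> x))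
        = (w z * iexp (Z z \<bullet> (x + ?s n *\<^sub>R v)) - w z * iexp (Z z \<bullet> x)) / of_real (?s n)" for z
      proof -
        define r where "r = ?s n"
        have e: "iexp (Z z \<bullet> (x + r *\<^sub>R v)) = exp (of_real r * (\<i> * of_real (Z z \<bullet> v))) * iexp (Z z \<bullet> x)"
          by (simp add: inner_add_right distrib_left exp_add mult_ac)
        show ?thesis unfolding r_def[symmetric] e
          by (simp add: left_diff_distrib right_diff_distrib diff_divide_distrib mult_ac)
      qed
      show ?thesis
        unfolding eq integral_divide_zero Bochner_Integration.integral_diff[OF i0 i0] rep[symmetric] by simp
    qed
    ultimately show "(\<lambda>n. complex_of_real ((h (x + ?s n *\<^sub>R v) - h x) / ?s n))
      \<longlonglongrightarrow> (CLINT z|Q. w z * (\<i> * of_real (Z z \<bullet> v) * iexp (Z z \<bullet> x)))" by simp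
  qed
  have jump_rep: "of_real (jump h D x u) = (CLINT z|Q. w z * (iexp (Z z \<bullet> x) * levy_integrand (Z z) u))" for x u
  proof -
    let ?I = "indicator {u. norm u \<le> 1} u :: real"
    have "of_real (jump h D x u) = (CLINT z|Q. w z * iexp (Z z \<bullet> (x + u))) - (CLINT z|Q. w z * iexp (Z z \<bullet> x))
        - (CLINT z|Q. w z * (\<i> * of_real (Z z \<bullet> u) * iexp (Z z \<bullet> x))) * of_real ?I"
      by (simp add: jump_def rep[symmetric] grad[symmetric])
    also have "\<dots> = (CLINT z|Q. w z * iexp (Z z \<bullet> (x + u)) - w z * iexp (Z z \<bullet> x)
        - (w z * (\<i> * of_real (Z z \<bullet> u) * iexp (Z z \<bullet> x))) * of_real ?I)"
      using i0[of x] i0[of "x + u"] i1[of u x] by simp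
    also have "\<dots> = (CLINT z|Q. w z * (iexp (Z z \<bullet> x) * levy_integrand (Z z) u))"
      by (intro Bochner_Integration.integral_cong refl)
        (simp add: levy_integrand_def inner_add_right exp_add distrib_left right_diff_distrib mult_ac)
    finally show ?thesis .
  qed
  have gen_rep: "of_real (gen h D x) = (CLINT z|Q. w z * (iexp (Z z \<bullet> x) * eta (Z z)))" for x
  proof -
    have "(CLINT u|\<nu>. complex_of_real (jump h D x u)) = (CLINT u|\<nu>. (CLINT z|Q. w z * (iexp (Z z \<bullet> x) * levy_integrand (Z z) u)))"
      unfolding jump_rep ..
    \<comment> \<open>Fubini holds because the integrand is dominated by a product, quadratic in
      \<open>Z z\<close> and of the form \<open>min 1 ((norm u)\<^sup>2)\<close> in the
      jump.\<close>
    also have "\<dots> = (CLINT z|Q. (CLINT u|\<nu>. w z * (iexp (Z z \<bullet> x) * levy_integrand (Z z) u)))"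
    proof (rule QN.Fubini_integral)
      show "integrable (Q \<Otimes>\<^sub>M \<nu>) (\<lambda>(z, u). w z * (iexp (Z z \<bullet> x) * levy_integrand (Z z) u))"
      proof (rule Bochner_Integration.integrable_bound[OF QN.integrable_times[OF int2 integrable_min]])
        show "(\<lambda>(z, u). w z * (iexp (Z z \<bullet> x) * levy_integrand (Z z) u)) \<in> borel_measurable (Q \<Otimes>\<^sub>M \<nu>)" by measurable
        have "cmod (w z * (iexp (Z z \<bullet> x) * levy_integrand (Z z) u)) \<le> W * (2 + (norm (Z z))\<^sup>2) * min 1 ((norm u)\<^sup>2)" for z u
          unfolding mult.assoc[of W] by (rule w_le) (use levy_integrand_bound[of "Z z" u] in \<open>simp add: norm_mult\<close>)
        then show "AE p in Q \<Otimes>\<^sub>M \<nu>. norm (case p of (z, u) \<Rightarrow> w z * (iexp (Z z \<bullet> x) * levy_integrand (Z z) u))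
            \<le> norm (case p of (z, u) \<Rightarrow> W * (2 + (norm (Z z))\<^sup>2) * min 1 ((norm u)\<^sup>2))"
          by (auto intro!: AE_I2 order_trans[OF _ abs_ge_self])
      qed
    qed
    also have "\<dots> = (CLINT z|Q. w z * (iexp (Z z \<bullet> x) * psi (Z z)))" by (simp add: psi_def)
    finally have j: "complex_of_real (LINT u|\<nu>. jump h D x u) = (CLINT z|Q. w z * (iexp (Z z \<bullet> x) * psi (Z z)))"
      by (simp only: integral_complex_of_real)
    have "integrable Q (\<lambda>z. w z * (iexp (Z z \<bullet> x) * psi (Z z)))"
    proof (rule int_bd[of _ gen_norm])
      show "cmod (w z * (iexp (Z z \<bullet> x) * psi (Z z))) \<le> W * (2 + (norm (Z z))\<^sup>2) * gen_norm" for z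
        unfolding mult.assoc[of W] by (rule w_le) (use psi_bound[of "Z z"] in \<open>simp add: norm_mult\<close>)
    qed measurable
    with i1[of b x] have "(CLINT z|Q. w z * (\<i> * of_real (Z z \<bullet> b) * iexp (Z z \<bullet> x)) + w z * (iexp (Z z \<bullet> x) * psi (Z z)))
      = of_real (D x \<bullet> b) + complex_of_real (LINT u|\<nu>. jump h D x u)"
      unfolding grad j by (rule Bochner_Integration.integral_add)
    moreover have "w z * (\<i> * of_real (Z z \<bullet> b) * iexp (Z z \<bullet> x)) + w z * (iexp (Z z \<bullet> x) * psi (Z z))
        = w z * (iexp (Z z \<bullet> x) * eta (Z z))" for z
      by (simp add: eta_def inner_commute algebra_simps)
    ultimately show ?thesis by (simp add: gen_def inner_commute)
  qed
  have eta_w: "cmod (w z * (k * eta (Z z))) \<le> W * (2 * (2 + (norm (Z z))\<^sup>2) * gen_norm)" if "cmod k \<le> 1" for z k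
    using that by (intro w_le order_trans[OF _ eta_bound[of "Z z"]]) (simp add: norm_mult mult_left_le_one_le)
  have gen_E: "of_real (LINT \<omega>|M. gen h D (X \<omega>)) = (CLINT z|Q. w z * (exp (eta (Z z)) * eta (Z z)))"
  proof -
    have "(CLINT \<omega>|M. complex_of_real (gen h D (X \<omega>))) = (CLINT \<omega>|M. (CLINT z|Q. w z * (iexp (Z z \<bullet> X \<omega>) * eta (Z z))))"
      unfolding gen_rep ..
    also have "\<dots> = (CLINT z|Q. (CLINT \<omega>|M. w z * (iexp (Z z \<bullet> X \<omega>) * eta (Z z))))"
    proof (rule MQ.Fubini_integral[symmetric])
      show "integrable (M \<Otimes>\<^sub>M Q) (\<lambda>(\<omega>, z). w z * (iexp (Z z \<bullet> X \<omega>) * eta (Z z)))"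
      proof (rule Bochner_Integration.integrable_bound[OF MQ.integrable_times[OF integrable_const[of 1] int_eta]])
        show "AE p in M \<Otimes>\<^sub>M Q. norm (case p of (\<omega>, z) \<Rightarrow> w z * (iexp (Z z \<bullet> X \<omega>) * eta (Z z)))
          \<le> norm (case p of (\<omega>, z) \<Rightarrow> 1 * (W * (2 * (2 + (norm (Z z))\<^sup>2) * gen_norm)))"
          using eta_w by (auto intro!: AE_I2 order_trans[OF _ abs_ge_self])
      qed measurable
    qed
    also have "\<dots> = (CLINT z|Q. w z * (char_fun M X (Z z) * eta (Z z)))" by (simp add: char_fun_def)
    finally show ?thesis unfolding stable by (simp only: integral_complex_of_real)
  qed
  \<comment> \<open>Dilating X by c dilates the frequencies, and homogeneity turns this into the
    factor c in the exponent. E h(cX) thereby becomes explicitly differentiable in c.\<close>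
  have radial: "of_real (LINT \<omega>|M. h (c *\<^sub>R X \<omega>)) = (CLINT z|Q. w z * exp (of_real c * eta (Z z)))" if c: "c > 0" for c
  proof -
    have "(CLINT \<omega>|M. complex_of_real (h (c *\<^sub>R X \<omega>))) = (CLINT \<omega>|M. (CLINT z|Q. w z * iexp ((c *\<^sub>R Z z) \<bullet> X \<omega>)))"
      unfolding rep by (simp add: mult_ac)
    also have "\<dots> = (CLINT z|Q. (CLINT \<omega>|M. w z * iexp ((c *\<^sub>R Z z) \<bullet> X \<omega>)))"
    proof (rule MQ.Fubini_integral[symmetric])
      show "integrable (M \<Otimes>\<^sub>M Q) (\<lambda>(\<omega>, z). w z * iexp ((c *\<^sub>R Z z) \<bullet> X \<omega>))"
      proof (rule Bochner_Integration.integrable_bound[OF MQ.integrable_times[OF integrable_const[of 1] Q.integrable_const[of W]]])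
        show "AE p in M \<Otimes>\<^sub>M Q. norm (case p of (\<omega>, z) \<Rightarrow> w z * iexp ((c *\<^sub>R Z z) \<bullet> X \<omega>)) \<le> norm (case p of (\<omega>, z) \<Rightarrow> 1 * W)"
          using W W0 by (auto intro!: AE_I2 simp: norm_mult)
      qed measurable
    qed
    also have "\<dots> = (CLINT z|Q. w z * char_fun M X (c *\<^sub>R Z z))" by (simp add: char_fun_def)
    finally show ?thesis unfolding stable eta_scale[OF c] by (simp only: integral_complex_of_real)
  qed
  \<comment> \<open>Stability makes exp(\<eta>) a characteristic function, of modulus at most 1.
    This puts the exponents into the half-plane required by
    \<open>exp_quotient_bound\<close>.\<close>
  have Re_eta: "Re (eta \<xi>) \<le> 0" for \<xi>
    using char_fun_bound[of \<xi>] unfolding stable by simp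
  have hint: "integrable M (\<lambda>\<omega>. h (c *\<^sub>R X \<omega>))" for c
    using tame_measurable[OF t] tameD(2)[OF t] by (intro integrable_const_bound[where B=C]) auto
  have exint: "integrable Q (\<lambda>z. w z * exp (of_real c * eta (Z z)))" if "c > 0" for c :: real
    using Re_eta that by (intro Q.integrable_const_bound[where B="W * 1"] AE_I2 w_le) (auto simp: mult_nonneg_nonpos)
  note [measurable] = tame_measurable[OF t] tameD(1)[OF t]
  \<comment> \<open>\<open>lim1\<close> and \<open>lim2\<close> are limits of the same difference
    quotient of E h(tX) at t = 1, taken under the expectation and under Q respectively.\<close>
  have lim1: "(\<lambda>n. LINT \<omega>|M. (h (X \<omega> + ?s n *\<^sub>R X \<omega>) - h (X \<omega>)) / ?s n) \<longlonglongrightarrow> (LINT \<omega>|M. X \<omega> \<bullet> D (X \<omega>))"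
  proof (rule integral_dominated_convergence[where w="\<lambda>_. C"])
    show "AE \<omega> in M. (\<lambda>n. (h (X \<omega> + ?s n *\<^sub>R X \<omega>) - h (X \<omega>)) / ?s n) \<longlonglongrightarrow> X \<omega> \<bullet> D (X \<omega>)"
      unfolding inner_commute[of "X _"] by (intro AE_I2 tame_quotient_tendsto[OF t])
    show "AE \<omega> in M. norm ((h (X \<omega> + ?s n *\<^sub>R X \<omega>) - h (X \<omega>)) / ?s n) \<le> C" for n
      unfolding real_norm_def by (intro AE_I2 radial_increment_bound[OF t d]) simp
  qed measurable
  have lim2: "(\<lambda>n. CLINT z|Q. w z * (exp (eta (Z z)) * ((exp (of_real (?s n) * eta (Z z)) - 1) / of_real (?s n))))
     \<longlonglongrightarrow> (CLINT z|Q. w z * (exp (eta (Z z)) * eta (Z z)))"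
  proof (rule integral_dominated_convergence[OF _ _ int_eta])
    show "AE z in Q. (\<lambda>n. w z * (exp (eta (Z z)) * ((exp (of_real (?s n) * eta (Z z)) - 1) / of_real (?s n))))
      \<longlonglongrightarrow> w z * (exp (eta (Z z)) * eta (Z z))"
      by (intro AE_I2 tendsto_mult tendsto_const exp_quotient_tendsto)
    show "AE z in Q. norm (w z * (exp (eta (Z z)) * ((exp (of_real (?s n) * eta (Z z)) - 1) / of_real (?s n))))
      \<le> W * (2 * (2 + (norm (Z z))\<^sup>2) * gen_norm)" for n
    proof (intro AE_I2 w_le)
      fix z
      have "cmod (exp (eta (Z z)) * ((exp (of_real (?s n) * eta (Z z)) - 1) / of_real (?s n))) \<le> 1 * cmod (eta (Z z))"
        unfolding norm_mult by (intro mult_mono exp_quotient_bound Re_eta) (use Re_eta in auto)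
      then show "cmod (exp (eta (Z z)) * ((exp (of_real (?s n) * eta (Z z)) - 1) / of_real (?s n))) \<le> 2 * (2 + (norm (Z z))\<^sup>2) * gen_norm"
        using eta_bound[of "Z z"] by linarith
    qed
  qed measurable
  have "(CLINT z|Q. w z * (exp (eta (Z z)) * ((exp (of_real (?s n) * eta (Z z)) - 1) / of_real (?s n))))
      = complex_of_real (LINT \<omega>|M. (h (X \<omega> + ?s n *\<^sub>R X \<omega>) - h (X \<omega>)) / ?s n)" for n
  proof -
    have eq: "w z * (exp (eta (Z z)) * ((exp (of_real (?s n) * eta (Z z)) - 1) / of_real (?s n)))
       = (w z * exp (of_real (1 + ?s n) * eta (Z z)) - w z * exp (of_real 1 * eta (Z z))) / of_real (?s n)" for z
    proof -
      define r where "r = ?s n"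
      show ?thesis unfolding r_def[symmetric]
        by (simp add: distrib_right exp_add right_diff_distrib diff_divide_distrib mult_ac)
    qed
    have s: "1 + ?s n > 0" by (simp add: add_pos_nonneg)
    have "(CLINT z|Q. w z * (exp (eta (Z z)) * ((exp (of_real (?s n) * eta (Z z)) - 1) / of_real (?s n))))
      = ((CLINT z|Q. w z * exp (of_real (1 + ?s n) * eta (Z z))) - (CLINT z|Q. w z * exp (of_real 1 * eta (Z z)))) / of_real (?s n)"
      unfolding eq integral_divide_zero
      by (subst Bochner_Integration.integral_diff[OF exint[OF s] exint[OF zero_less_one]]) (rule refl)
    also have "\<dots> = complex_of_real (((LINT \<omega>|M. h ((1 + ?s n) *\<^sub>R X \<omega>)) - (LINT \<omega>|M. h (1 *\<^sub>R X \<omega>))) / ?s n)"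
      unfolding radial[OF s, symmetric] radial[OF zero_less_one, symmetric] by simp
    also have "((LINT \<omega>|M. h ((1 + ?s n) *\<^sub>R X \<omega>)) - (LINT \<omega>|M. h (1 *\<^sub>R X \<omega>))) / ?s n
       = (LINT \<omega>|M. (h (X \<omega> + ?s n *\<^sub>R X \<omega>) - h (X \<omega>)) / ?s n)"
      unfolding Bochner_Integration.integral_diff[OF hint hint, symmetric] integral_divide_zero[symmetric]
      by (simp only: scaleR_left_distrib scaleR_one)
    finally show ?thesis .
  qed
  with lim2 gen_E have "(\<lambda>n. complex_of_real (LINT \<omega>|M. (h (X \<omega> + ?s n *\<^sub>R X \<omega>) - h (X \<omega>)) / ?s n))
     \<longlonglongrightarrow> of_real (LINT \<omega>|M. gen h D (X \<omega>))" by simp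
  then have "(\<lambda>n. LINT \<omega>|M. (h (X \<omega> + ?s n *\<^sub>R X \<omega>) - h (X \<omega>)) / ?s n) \<longlonglongrightarrow> (LINT \<omega>|M. gen h D (X \<omega>))"
    by (simp only: tendsto_of_real_iff)
  with lim1 show ?thesis by (rule LIMSEQ_unique)
qed

end

section \<open>Gaussian mollification and its Fourier representation\<close>

definition mollify :: "real \<Rightarrow> ('a::euclidean_space \<Rightarrow> 'b::{banach, second_countable_topology}) \<Rightarrow> 'a \<Rightarrow> 'b" where
  "mollify \<epsilon> f x = (LINT z|gauss. f (x + \<epsilon> *\<^sub>R z))"

lemma mollify_integrable:
  fixes f :: "'a::euclidean_space \<Rightarrow> 'b::{banach, second_countable_topology}"
  assumes [measurable]: "f \<in> borel_measurable borel" and b: "\<And>x. norm (f x) \<le> C"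
  shows "integrable gauss (\<lambda>z. f (x + \<epsilon> *\<^sub>R z))"
proof -
  interpret prob_space "gauss :: 'a measure" by (rule prob_space_gauss)
  show ?thesis by (rule integrable_const_bound[where B=C]) (use b in auto)
qed

lemma mollify_norm_le:
  fixes f :: "'a::euclidean_space \<Rightarrow> 'b::{banach, second_countable_topology}"
  assumes f: "f \<in> borel_measurable borel" and b: "\<And>x. norm (f x) \<le> C"
  shows "norm (mollify \<epsilon> f x) \<le> C"
proof -
  interpret prob_space "gauss :: 'a measure" by (rule prob_space_gauss)
  have "norm (mollify \<epsilon> f x) \<le> (LINT z|gauss. norm (f (x + \<epsilon> *\<^sub>R z)))"
    unfolding mollify_def by (rule integral_norm_bound)
  also have "\<dots> \<le> C"
    by (intro integral_le_const integrable_norm mollify_integrable[OF f b]) (use b in simp)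
  finally show ?thesis .
qed

lemma mollify_measurable:
  fixes f :: "'a::euclidean_space \<Rightarrow> 'b::{banach, second_countable_topology}"
  assumes [measurable]: "f \<in> borel_measurable borel"
  shows "mollify \<epsilon> f \<in> borel_measurable borel"
proof -
  interpret prob_space "gauss :: 'a measure" by (rule prob_space_gauss)
  show ?thesis unfolding mollify_def[abs_def] by measurable
qed

lemma mollify_tendsto:
  fixes f :: "'a::euclidean_space \<Rightarrow> 'b::{banach, second_countable_topology}"
  assumes f: "continuous_on UNIV f" and b: "\<And>x. norm (f x) \<le> C" and \<epsilon>: "\<epsilon> \<longlonglongrightarrow> 0"
  shows "(\<lambda>n. mollify (\<epsilon> n) f x) \<longlonglongrightarrow> f x"
proof -
  interpret prob_space "gauss :: 'a measure" by (rule prob_space_gauss)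
  have [measurable]: "f \<in> borel_measurable borel" using f by (rule borel_measurable_continuous_onI)
  have "(\<lambda>n. mollify (\<epsilon> n) f x) \<longlonglongrightarrow> (LINT z::'a|gauss. f x)"
    unfolding mollify_def
  proof (rule integral_dominated_convergence[where w="\<lambda>_. C"])
    show "AE z in gauss. (\<lambda>n. f (x + \<epsilon> n *\<^sub>R z)) \<longlonglongrightarrow> f x"
    proof (intro AE_I2)
      fix z :: 'a
      have "(\<lambda>n. x + \<epsilon> n *\<^sub>R z) \<longlonglongrightarrow> x + 0 *\<^sub>R z" by (intro tendsto_intros \<epsilon>)
      then have "(\<lambda>n. x + \<epsilon> n *\<^sub>R z) \<longlonglongrightarrow> x" by simp
      moreover have "isCont f x" using f by (simp add: continuous_on_eq_continuous_at)
      ultimately show "(\<lambda>n. f (x + \<epsilon> n *\<^sub>R z)) \<longlonglongrightarrow> f x" by (rule isCont_tendsto_compose[rotated])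
    qed
  qed (use b in auto)
  then show ?thesis using prob_space by simp
qed

text \<open>Each pointwise bound in \<open>tame\<close> concerns an expression linear in the pair
  (f, D), so it survives averaging over translates with the same constant. Mollifying D by the same
  operator avoids differentiating under the integral.\<close>

lemma mollify_tame:
  fixes f :: "'a::euclidean_space \<Rightarrow> real"
  assumes t: "tame C f D"
  shows "tame C (mollify \<epsilon> f) (mollify \<epsilon> D)"
  unfolding tame_def
proof (intro conjI allI)
  interpret prob_space "gauss :: 'a measure" by (rule prob_space_gauss)
  note m = tame_measurable[OF t] tameD(1)[OF t]
  note Di = mollify_integrable[OF m(2) tameD(3)[OF t]]
  show "mollify \<epsilon> D \<in> borel_measurable borel" by (rule mollify_measurable[OF m(2)])
  fix x
  show "\<bar>mollify \<epsilon> f x\<bar> \<le> C" using mollify_norm_le[OF m(1), of C] tameD(2)[OF t] by simp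
  show "norm (mollify \<epsilon> D x) \<le> C" using mollify_norm_le[OF m(2) tameD(3)[OF t]] .
  fix u
  have fi: "integrable gauss (\<lambda>z. f (y + \<epsilon> *\<^sub>R z))" for y
    by (rule mollify_integrable[OF m(1), of C]) (use tameD(2)[OF t] in simp)
  have i: "integrable gauss (\<lambda>z. f ((x + u) + \<epsilon> *\<^sub>R z) - f (x + \<epsilon> *\<^sub>R z) - D (x + \<epsilon> *\<^sub>R z) \<bullet> u)"
    by (intro Bochner_Integration.integrable_diff fi integrable_inner_left Di)
  have eq: "mollify \<epsilon> f (x + u) - mollify \<epsilon> f x - mollify \<epsilon> D x \<bullet> u
    = (LINT z|gauss. f ((x + u) + \<epsilon> *\<^sub>R z) - f (x + \<epsilon> *\<^sub>R z) - D (x + \<epsilon> *\<^sub>R z) \<bullet> u)"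
    unfolding mollify_def
    using fi[of x] fi[of "x + u"] Di[of x \<epsilon>] by simp
  have "\<bar>mollify \<epsilon> f (x + u) - mollify \<epsilon> f x - mollify \<epsilon> D x \<bullet> u\<bar> \<le> (LINT z|gauss. \<bar>f ((x + u) + \<epsilon> *\<^sub>R z) - f (x + \<epsilon> *\<^sub>R z) - D (x + \<epsilon> *\<^sub>R z) \<bullet> u\<bar>)"
    unfolding eq by (rule integral_abs_bound)
  also have "\<dots> \<le> C * (norm u)\<^sup>2"
  proof (rule integral_le_const[OF integrable_abs[OF i]], intro AE_I2)
    fix z
    show "\<bar>f ((x + u) + \<epsilon> *\<^sub>R z) - f (x + \<epsilon> *\<^sub>R z) - D (x + \<epsilon> *\<^sub>R z) \<bullet> u\<bar> \<le> C * (norm u)\<^sup>2"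
      using tameD(4)[OF t, of "x + \<epsilon> *\<^sub>R z" u] by (simp add: add_ac)
  qed
  finally show "\<bar>mollify \<epsilon> f (x + u) - mollify \<epsilon> f x - mollify \<epsilon> D x \<bullet> u\<bar> \<le> C * (norm u)\<^sup>2" .
qed

text \<open>Moving the weight from x to the translated point costs norm z, which has a finite
  Gaussian mean. The restriction to widths at most 1 keeps the constant independent of the
  width.\<close>

lemma mollify_decay:
  fixes D :: "'a::euclidean_space \<Rightarrow> 'a"
  assumes m: "D \<in> borel_measurable borel" and b: "\<And>x. norm (D x) \<le> C" "\<And>x. norm x * norm (D x) \<le> C"
    and \<epsilon>: "0 \<le> \<epsilon>" "\<epsilon> \<le> 1"
  shows "norm x * norm (mollify \<epsilon> D x) \<le> C + C * (LINT z::'a|gauss. norm z)"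
proof -
  interpret prob_space "gauss :: 'a measure" by (rule prob_space_gauss)
  have i: "integrable gauss (\<lambda>z. norm (D (x + \<epsilon> *\<^sub>R z)))"
    by (intro integrable_norm mollify_integrable[OF m b(1)])
  have C: "0 \<le> C" using norm_ge_zero b(1) by (rule order_trans)
  have "norm x * norm (mollify \<epsilon> D x) \<le> norm x * (LINT z|gauss. norm (D (x + \<epsilon> *\<^sub>R z)))"
    unfolding mollify_def by (intro mult_left_mono integral_norm_bound) simp
  also have "\<dots> = (LINT z|gauss. norm x * norm (D (x + \<epsilon> *\<^sub>R z)))" by simp
  also have "\<dots> \<le> (LINT z::'a|gauss. C + C * norm z)"
  proof (rule integral_mono)
    show "integrable gauss (\<lambda>z. norm x * norm (D (x + \<epsilon> *\<^sub>R z)))" using i by (rule integrable_mult_right)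
    show "integrable gauss (\<lambda>z::'a. C + C * norm z)"
      by (intro Bochner_Integration.integrable_add integrable_mult_right gauss_integrable_norm integrable_const)
    fix z :: 'a
    have "norm x \<le> norm (x + \<epsilon> *\<^sub>R z) + norm (\<epsilon> *\<^sub>R z)"
      using norm_triangle_ineq4[of "x + \<epsilon> *\<^sub>R z" "\<epsilon> *\<^sub>R z"] by simp
    also have "\<dots> \<le> norm (x + \<epsilon> *\<^sub>R z) + norm z" using \<epsilon> by (simp add: mult_left_le_one_le)
    finally have "norm x * norm (D (x + \<epsilon> *\<^sub>R z)) \<le> (norm (x + \<epsilon> *\<^sub>R z) + norm z) * norm (D (x + \<epsilon> *\<^sub>R z))"
      by (intro mult_right_mono) auto
    also have "\<dots> \<le> C + C * norm z"
      using b(2)[of "x + \<epsilon> *\<^sub>R z"] mult_left_mono[OF b(1)[of "x + \<epsilon> *\<^sub>R z"] norm_ge_zero[of z]]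
      unfolding distrib_right mult.commute[of C] by linarith
    finally show "norm x * norm (D (x + \<epsilon> *\<^sub>R z)) \<le> C + C * norm z" .
  qed
  also have "\<dots> = C + C * (LINT z::'a|gauss. norm z)"
    using gauss_integrable_norm[where 'a='a] prob_space
    by (subst Bochner_Integration.integral_add) auto
  finally show ?thesis .
qed

text \<open>
  A Gaussian density is, up to a constant, the Fourier transform of \<open>gauss\<close>; Fubini then puts
  the Fourier transform of \<open>f\<close> into the weight \<open>w\<close>.
\<close>

lemma mollify_fourier:
  fixes f :: "'a::euclidean_space \<Rightarrow> real"
  assumes f: "integrable lborel f" and \<epsilon>: "0 < \<epsilon>"
  obtains w W where "w \<in> borel_measurable (gauss :: 'a measure)" "\<And>z. cmod (w z) \<le> W"
    "\<And>x. of_real (mollify \<epsilon> f x) = (CLINT z|gauss. w z * iexp ((- (1 / \<epsilon>)) *\<^sub>R z \<bullet> x))"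
proof -
  have [measurable]: "f \<in> borel_measurable borel" using f by auto
  interpret g: prob_space "gauss :: 'a measure" by (rule prob_space_gauss)
  interpret lg: pair_sigma_finite "lborel :: 'a measure" "gauss :: 'a measure" ..
  \<comment> \<open>\<open>gauss_const\<close> comes from writing the Gaussian as a Fourier
    transform, the power of \<epsilon> from the substitution y = x + \<epsilon>z.\<close>
  define c where "c = gauss_const TYPE('a) / \<epsilon> ^ DIM('a)"
  define w where "w z = of_real c * (CLINT y|lborel. of_real (f y) * iexp (((1 / \<epsilon>) *\<^sub>R z) \<bullet> y))" for z :: 'a
  have w: "w \<in> borel_measurable gauss"
    unfolding w_def[abs_def] by measurable
  have bound: "cmod (w z) \<le> \<bar>c\<bar> * (LINT y|lborel. \<bar>f y\<bar>)" for z
  proof -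
    have "cmod (CLINT y|lborel. of_real (f y) * iexp (((1 / \<epsilon>) *\<^sub>R z) \<bullet> y)) \<le> (LINT y|lborel. cmod (of_real (f y) * iexp (((1 / \<epsilon>) *\<^sub>R z) \<bullet> y)))"
      by (rule integral_norm_bound)
    also have "\<dots> = (LINT y|lborel. \<bar>f y\<bar>)" by (simp add: norm_mult)
    finally show ?thesis unfolding w_def norm_mult by (intro mult_mono) auto
  qed
  have "of_real (mollify \<epsilon> f x) = (CLINT z|gauss. w z * iexp ((- (1 / \<epsilon>)) *\<^sub>R z \<bullet> x))" for x
  proof -
    \<comment> \<open>The affine change of variables moves the translation and the width from f to
      the Gaussian, so that f appears at y alone.\<close>
    have lb: "(lborel :: 'a measure) = density (distr lborel borel (\<lambda>z. x + \<epsilon> *\<^sub>R z)) (\<lambda>_. ennreal (\<epsilon> ^ DIM('a)))"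
      using lborel_affine[of \<epsilon> x] \<epsilon> by simp
    have "(LINT y|lborel. gauss_density ((1 / \<epsilon>) *\<^sub>R (y - x)) * f y)
      = (LINT y|density (distr lborel borel (\<lambda>z. x + \<epsilon> *\<^sub>R z)) (\<lambda>_. ennreal (\<epsilon> ^ DIM('a))). gauss_density ((1 / \<epsilon>) *\<^sub>R (y - x)) * f y)"
      using lb by simp
    also have "\<dots> = (LINT y|distr lborel borel (\<lambda>z. x + \<epsilon> *\<^sub>R z). \<epsilon> ^ DIM('a) *\<^sub>R (gauss_density ((1 / \<epsilon>) *\<^sub>R (y - x)) * f y))"
      using \<epsilon> by (intro integral_density) auto
    also have "\<dots> = (LINT z|lborel. \<epsilon> ^ DIM('a) *\<^sub>R (gauss_density ((1 / \<epsilon>) *\<^sub>R ((x + \<epsilon> *\<^sub>R z) - x)) * f (x + \<epsilon> *\<^sub>R z)))"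
      by (intro integral_distr) auto
    also have "\<dots> = \<epsilon> ^ DIM('a) * (LINT z|lborel. gauss_density z *\<^sub>R f (x + \<epsilon> *\<^sub>R z))" using \<epsilon> by simp
    also have "(LINT z|lborel. gauss_density z *\<^sub>R f (x + \<epsilon> *\<^sub>R z)) = mollify \<epsilon> f x"
      unfolding mollify_def gauss_def by (intro integral_density[symmetric]) (auto simp: gauss_density_nonneg)
    finally have "mollify \<epsilon> f x = (LINT y|lborel. gauss_density ((1 / \<epsilon>) *\<^sub>R (y - x)) * f y) / \<epsilon> ^ DIM('a)"
      using \<epsilon> by simp
    then have "complex_of_real (mollify \<epsilon> f x)
        = (CLINT y|lborel. complex_of_real (gauss_density ((1 / \<epsilon>) *\<^sub>R (y - x)) * f y)) / of_real (\<epsilon> ^ DIM('a))"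
      by (simp only: integral_complex_of_real of_real_divide)
    also have "(CLINT y|lborel. complex_of_real (gauss_density ((1 / \<epsilon>) *\<^sub>R (y - x)) * f y))
       = of_real (gauss_const TYPE('a)) * (CLINT y|lborel. (CLINT z|gauss. of_real (f y) * iexp ((1 / \<epsilon>) *\<^sub>R (y - x) \<bullet> z)))"
      by (simp add: gauss_density_fourier mult_ac flip: integral_mult_right_zero)
    also have "(CLINT y|lborel. (CLINT z|gauss. of_real (f y) * iexp ((1 / \<epsilon>) *\<^sub>R (y - x) \<bullet> z)))
      = (CLINT z|gauss. (CLINT y|lborel. of_real (f y) * iexp ((1 / \<epsilon>) *\<^sub>R (y - x) \<bullet> z)))"
    proof (rule lg.Fubini_integral[symmetric])
      show "integrable (lborel \<Otimes>\<^sub>M gauss) (\<lambda>(y, z). of_real (f y) * iexp ((1 / \<epsilon>) *\<^sub>R (y - x) \<bullet> z))"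
        by (rule Bochner_Integration.integrable_bound[OF lg.integrable_times[OF f g.integrable_const[of 1]]])
          (auto intro!: AE_I2 simp: norm_mult)
    qed
    also have "\<dots> = (CLINT z|gauss. (CLINT y|lborel. of_real (f y) * iexp (((1 / \<epsilon>) *\<^sub>R z) \<bullet> y)) * iexp ((- (1 / \<epsilon>)) *\<^sub>R z \<bullet> x))"
    proof (intro Bochner_Integration.integral_cong refl)
      fix z
      have "of_real (f y) * iexp ((1 / \<epsilon>) *\<^sub>R (y - x) \<bullet> z)
        = of_real (f y) * iexp (((1 / \<epsilon>) *\<^sub>R z) \<bullet> y) * iexp ((- (1 / \<epsilon>)) *\<^sub>R z \<bullet> x)" for y
      proof -
        have "(1 / \<epsilon>) *\<^sub>R (y - x) \<bullet> z = ((1 / \<epsilon>) *\<^sub>R z) \<bullet> y + (- (1 / \<epsilon>)) *\<^sub>R z \<bullet> x"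
          by (simp add: inner_diff_left inner_commute[of z] diff_divide_distrib right_diff_distrib)
        then show ?thesis by (simp only: of_real_add distrib_left exp_add mult.assoc)
      qed
      then show "(CLINT y|lborel. of_real (f y) * iexp ((1 / \<epsilon>) *\<^sub>R (y - x) \<bullet> z))
        = (CLINT y|lborel. of_real (f y) * iexp (((1 / \<epsilon>) *\<^sub>R z) \<bullet> y)) * iexp ((- (1 / \<epsilon>)) *\<^sub>R z \<bullet> x)"
        by (simp only: integral_mult_left_zero)
    qed
    finally have "of_real (mollify \<epsilon> f x) = of_real c * (CLINT z|gauss. (CLINT y|lborel. of_real (f y) * iexp (((1 / \<epsilon>) *\<^sub>R z) \<bullet> y)) * iexp ((- (1 / \<epsilon>)) *\<^sub>R z \<bullet> x))"
      by (simp only: c_def of_real_divide times_divide_eq_left mult.commute)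
    then show ?thesis unfolding w_def mult.assoc by (simp only: integral_mult_right_zero)
  qed
  with w bound show ?thesis by (rule that)
qed

context levy_vector begin

text \<open>For each positive width the mollified function is a mixture of exponentials, to which
  \<open>stein_mixture\<close> applies. Its weight bound W may depend on the width, because only the
  finished identity is passed to the limit, under bounds that do not.\<close>

lemma stable_imp_stein:
  assumes stable: "\<And>\<xi>. char_fun M X \<xi> = exp (eta \<xi>)" and f: "schwartz_function f"
  shows "stein f"
proof -
  let ?D = "gradient f"
  obtain C where t: "tame C f ?D" and d: "\<And>x. norm x * norm (?D x) \<le> C" and cont: "continuous_on UNIV ?D"
    using schwartz_tame[OF f] by blast
  define s where "s n = 1 / real (Suc n)" for n
  have s: "0 < s n" "s n \<le> 1" for n by (simp_all add: s_def)
  have s0: "s \<longlonglongrightarrow> 0" unfolding s_def using LIMSEQ_inverse_real_of_nat by (simp add: inverse_eq_divide)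
  \<comment> \<open>The common constant that \<open>stein_mixture\<close> asks for in both the tame
    bounds and the radial decay; mollifying enlarges only the latter.\<close>
  define C' where "C' = C + C * (LINT z::'a|gauss. norm z)"
  have CC': "C \<le> C'" using tameD(5)[OF t] by (simp add: C'_def)
  have ts: "tame C (mollify (s n) f) (mollify (s n) ?D)" for n by (rule mollify_tame[OF t])
  have ds: "norm x * norm (mollify (s n) ?D x) \<le> C'" for n x
    unfolding C'_def by (rule mollify_decay[OF tameD(1)[OF t] tameD(3)[OF t] d]) (use s[of n] in auto)
  have eq: "(LINT \<omega>|M. X \<omega> \<bullet> mollify (s n) ?D (X \<omega>)) = (LINT \<omega>|M. gen (mollify (s n) f) (mollify (s n) ?D) (X \<omega>))" for n
  proof -
    obtain w W where w: "w \<in> borel_measurable (gauss :: 'a measure)" "\<And>z. cmod (w z) \<le> W"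
      "\<And>x. of_real (mollify (s n) f x) = (CLINT z|gauss. w z * iexp ((- (1 / s n)) *\<^sub>R z \<bullet> x))"
      using mollify_fourier[OF schwartz_integrable[OF f] s(1)] by blast
    show ?thesis
    proof (rule stein_mixture[OF stable _ _ _ w(1,2) tame_mono[OF ts CC'] ds w(3)])
      show "finite_measure (gauss :: 'a measure)"
        using prob_space_gauss by (rule prob_space.finite_measure)
      show "integrable gauss (\<lambda>z::'a. (norm ((- (1 / s n)) *\<^sub>R z))\<^sup>2)"
        using gauss_integrable_norm2[where 'a='a] by (simp add: power_divide)
    qed measurable
  qed
  have fc: "continuous_on UNIV f"
    by (intro continuous_at_imp_continuous_on ballI has_derivative_continuous[OF tame_has_derivative[OF t]])
  have fl: "(\<lambda>n. mollify (s n) f x) \<longlonglongrightarrow> f x" for x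
    by (rule mollify_tendsto[OF fc _ s0, of C]) (use tameD(2)[OF t] in simp)
  have Dl: "(\<lambda>n. mollify (s n) ?D x) \<longlonglongrightarrow> ?D x" for x
    by (rule mollify_tendsto[OF cont tameD(3)[OF t] s0])
  note [measurable] = tameD(1)[OF t] tameD(1)[OF ts]
  have "(\<lambda>n. LINT \<omega>|M. X \<omega> \<bullet> mollify (s n) ?D (X \<omega>)) \<longlonglongrightarrow> (LINT \<omega>|M. X \<omega> \<bullet> ?D (X \<omega>))"
  proof (rule integral_dominated_convergence[where w="\<lambda>_. C'"])
    show "AE \<omega> in M. (\<lambda>n. X \<omega> \<bullet> mollify (s n) ?D (X \<omega>)) \<longlonglongrightarrow> X \<omega> \<bullet> ?D (X \<omega>)"
      by (intro AE_I2 tendsto_intros Dl)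
    show "AE \<omega> in M. norm (X \<omega> \<bullet> mollify (s n) ?D (X \<omega>)) \<le> C'" for n
      unfolding real_norm_def by (intro AE_I2 order_trans[OF Cauchy_Schwarz_ineq2 ds])
  qed measurable
  moreover have "(\<lambda>n. LINT \<omega>|M. gen (mollify (s n) f) (mollify (s n) ?D) (X \<omega>)) \<longlonglongrightarrow> (LINT \<omega>|M. gen f ?D (X \<omega>))"
  proof (rule integral_dominated_convergence[where w="\<lambda>_. C * gen_norm"])
    show "AE \<omega> in M. (\<lambda>n. gen (mollify (s n) f) (mollify (s n) ?D) (X \<omega>)) \<longlonglongrightarrow> gen f ?D (X \<omega>)"
      by (intro AE_I2 gen_tendsto[OF ts fl Dl tameD(1)[OF t]])
    show "AE \<omega> in M. norm (gen (mollify (s n) f) (mollify (s n) ?D) (X \<omega>)) \<le> C * gen_norm" for n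
      using gen_bound[OF ts] by simp
    show "(\<lambda>\<omega>. gen f ?D (X \<omega>)) \<in> borel_measurable M"
      using measurable_compose[OF X gen_measurable[OF t]] .
    show "(\<lambda>\<omega>. gen (mollify (s n) f) (mollify (s n) ?D) (X \<omega>)) \<in> borel_measurable M" for n
      using measurable_compose[OF X gen_measurable[OF ts]] .
  qed simp
  ultimately have "(LINT \<omega>|M. X \<omega> \<bullet> ?D (X \<omega>)) = (LINT \<omega>|M. gen f ?D (X \<omega>))"
    unfolding eq by (rule LIMSEQ_unique)
  then show ?thesis by (simp add: stein_iff_gen[OF t])
qed

end

theorem theorem3p2:
  fixes M :: "'w measure" and X :: "'w \<Rightarrow> 'a::euclidean_space"
    and b :: 'a and \<nu> \<sigma> :: "'a measure"
  assumes "prob_space M"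
    and "X \<in> borel_measurable M"
    and "levy_measure \<nu>"
    and "\<And>c::real. c > 0 \<Longrightarrow> \<nu> = scale_measure (ennreal (1 / c)) (dilate_measure c \<nu>)"
    and "spherical_part \<nu> \<sigma>"
    and "(LINT x|\<sigma>. x) = 0"
  shows "(\<forall>f. schwartz_function f \<longrightarrow>
            (LINT \<omega>|M. X \<omega> \<bullet> gradient f (X \<omega>)) =
            (LINT \<omega>|M. b \<bullet> gradient f (X \<omega>)) +
            (LINT \<omega>|M. (LINT u|\<nu>. f (X \<omega> + u) - f (X \<omega>)
               - (gradient f (X \<omega>) \<bullet> u) * indicator {u. norm u \<le> 1} u)))
         \<longleftrightarrow> stable_index_1 M X b \<nu>"
proof -
  interpret levy b \<nu> by (rule levy.intro) (rule assms)
  interpret levy_index_1 b \<nu> \<sigma> by unfold_locales (fact assms)+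
  interpret prob_space M by (rule assms)
  interpret levy_vector b \<nu> \<sigma> M X by unfold_locales (fact assms)
  have "stable_index_1 M X b \<nu> \<longleftrightarrow> (\<forall>\<xi>. char_fun M X \<xi> = exp (eta \<xi>))"
    by (simp add: stable_index_1_def eta_def psi_def levy_integrand_def)
  then show ?thesis
    unfolding stein_def[symmetric] using stein_imp_stable stable_imp_stein by blast
qed

end
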